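(* Suppose that $(X,T)$ is a transitive dynamical system. Then $\mathcal{M}_{dense}^*=\mathcal{M}_{Trans}$ and there exists a residual invariant subset $Y\subset X$ such that for any $x\in Y$ and any $f\in C(X)$ one has (1) $x\in Trans(X,T)$ and $V_T(x)=\mathcal{M}_{Trans}$; (2) $\underline{f}(x)=\inf_{y\in Trans(X,T)}\underline{f}(y)= \inf_{\mu\in \mathcal{M}_{Trans}}\int f\, d\mu\leq\sup_{\mu\in \mathcal{M}_{Trans}}\int f\, d\mu=\sup_{y\in Trans(X,T)}\overline{f}(y)= \overline{f}(x)$; (3) $V_T(x)\cap \mathcal{O}_{T}\neq\emptyset$ provided that $X=M$ is a manifold. In particular, if further $\sharp \mathcal{M}_{Trans}>1$, then $\mathcal{R}$ is open and dense in $C(X)$, and $Y\subset\bigcap_{f\in\mathcal{R}} I(f,T)$.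
   Context: $(X,d)$ is a compact metric space, $T:X\to X$ is continuous, and $(X,T)$ is called a dynamical system. It is transitive if for all nonempty open $U,V\subset X$ there is $n\in\mathbb{N}=\{0,1,2,\dots\}$ with $U\cap T^{-n}V\ne\emptyset$. $Trans(X,T)=\{x\in X\mid \{T^nx: n\in\mathbb{N}\}\text{ is dense in }X\}$. $\mathcal{M}(X)$ and $\mathcal{M}(X,T)$ are the spaces of Borel probability measures and of $T$-invariant Borel probability measures, with the weak* topology. $C(X)$ is the space of real continuous functions with the sup norm. A set is residual if it contains a dense $G_\delta$ subset. Fix a countable set $\{f_i\}_{i\ge1}\subset C(X)$ with $\|f_i\|=1$ such that $\rho(\mu_1,\mu_2)=\sum_{i\ge 1}2^{-i}|\int f_i d\mu_1-\int f_i d\mu_2|$ is a metric for the weak* topology on $\mathcal{M}(X)$. For $x\in X$, $V_T(x)$ is the set of weak* accumulation points of $\frac1n\sum_{i=0}^{n-1}\delta_{T^ix}$. $G^\mu_\varepsilon=\{x\in X\mid \rho(\mu,V_T(x))\le\varepsilon\}$, where $\rho(\mu,V_T(x))=\inf_{\nu\in V_T(x)}\rho(\mu,\nu)$. $\mathcal{M}_{dense}^*=\{\mu\in\mathcal{M}(X,T)\mid G^\mu_\varepsilon\text{ is dense in }X\text{ for any }\varepsilon>0\}$ and $\mathcal{M}_{Trans}=\bigcup_{y\in Trans(X,T)}V_T(y)$. For $f\in C(X)$, $\underline{f}(x)$ and $\overline{f}(x)$ are the liminf and limsup of $\frac1n\sum_{i=0}^{n-1}f(T^ix)$ as $n\to\infty$;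 $I(f,T)=\{x\in X\mid\underline f(x)\ne\overline f(x)\}$; $\mathcal{R}=\{f\in C(X)\mid I(f,T)\text{ is residual in }X\}$. If $X=M$ is a manifold, $\mu\in\mathcal{M}(X)$ is physical-like if for every $\varepsilon>0$ the set $G^\mu_\varepsilon$ has positive Lebesgue measure; $\mathcal{O}_T$ denotes the set of physical-like measures of $T$. *)

theory Defs
  imports "HOL-Probability.Probability"
begin

section \<open>Topological dynamics\<close>

definition transitive_system :: "('a::topological_space \<Rightarrow> 'a) \<Rightarrow> bool" where
  "transitive_system T \<longleftrightarrow>
    (\<forall>U V. open U \<longrightarrow> U \<noteq> {} \<longrightarrow> open V \<longrightarrow> V \<noteq> {} \<longrightarrow> (\<exists>n. U \<inter> (T ^^ n) -` V \<noteq> {}))"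

definition dense :: "'a::topological_space set \<Rightarrow> bool" where
  "dense S \<longleftrightarrow> closure S = UNIV"

definition residual :: "'a::topological_space set \<Rightarrow> bool" where
  "residual S \<longleftrightarrow> (\<exists>G. gdelta G \<and> dense G \<and> G \<subseteq> S)"

text \<open>In particular \<open>T ` Y \<subseteq> Y\<close>, and \<open>T ` Y = Y\<close> whenever \<open>T\<close> is onto.\<close>

definition invariant :: "('a \<Rightarrow> 'a) \<Rightarrow> 'a set \<Rightarrow> bool" where
  "invariant T Y \<longleftrightarrow> T -` Y = Y"

definition Trans :: "('a::topological_space \<Rightarrow> 'a) \<Rightarrow> 'a set" where
  "Trans T = {x. dense (range (\<lambda>n. (T ^^ n) x))}"


section \<open>Probability measures and the weak* topology\<close>

definition prob_measures :: "'a::topological_space measure set" where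
  "prob_measures = {\<mu>. sets \<mu> = sets borel \<and> prob_space \<mu>}"

definition invariant_measures :: "('a::topological_space \<Rightarrow> 'a) \<Rightarrow> 'a measure set" where
  "invariant_measures T = {\<mu> \<in> prob_measures. distr \<mu> borel T = \<mu>}"

text \<open>
  On a compact space the bounded continuous functions \<open>'a \<Rightarrow>\<^sub>C real\<close> are all the continuous
  functions, and their library norm is the sup norm.
\<close>

definition weak_star :: "'a::topological_space measure topology" where
  "weak_star = topology_generated_by
    {{\<mu> \<in> prob_measures. (\<integral>x. f x \<partial>\<mu>) \<in> U} | (f :: 'a \<Rightarrow>\<^sub>C real) U. open U}"

text \<open>
  The series is an \<open>infsum\<close> so that the value is nonnegative even for arguments that are not
  probability measures, as \<^locale>\<open>Metric_space\<close> demands; on probability measures it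
  converges absolutely.
\<close>

definition rho :: "(nat \<Rightarrow> 'a::topological_space \<Rightarrow>\<^sub>C real) \<Rightarrow> 'a measure \<Rightarrow> 'a measure \<Rightarrow> real" where
  "rho F \<mu> \<nu> = (\<Sum>\<^sub>\<infinity>i\<in>{1..}. \<bar>(\<integral>x. F i x \<partial>\<mu>) - (\<integral>x. F i x \<partial>\<nu>)\<bar> / 2 ^ i)"

definition metrizing_family :: "(nat \<Rightarrow> 'a::topological_space \<Rightarrow>\<^sub>C real) \<Rightarrow> bool" where
  "metrizing_family F \<longleftrightarrow>
    (\<forall>i\<ge>1. norm (F i) = 1) \<and>
    Metric_space prob_measures (rho F) \<and>
    Metric_space.mtopology prob_measures (rho F) = weak_star"

text \<open>The average of the Dirac masses at \<open>x, T x, \<dots>, T\<^sup>n\<^sup>-\<^sup>1 x\<close>, for \<open>n > 0\<close>.\<close>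

definition empirical_measure :: "('a::topological_space \<Rightarrow> 'a) \<Rightarrow> nat \<Rightarrow> 'a \<Rightarrow> 'a measure" where
  "empirical_measure T n x = distr (uniform_count_measure {..<n}) borel (\<lambda>i. (T ^^ i) x)"

lemma emeasure_empirical_measure:
  fixes T :: "'a::topological_space \<Rightarrow> 'a"
  assumes "n > 0" and B: "B \<in> sets borel"
  shows "emeasure (empirical_measure T n x) B
    = (\<Sum>i<n. emeasure (return borel ((T ^^ i) x)) B) / of_nat n"
proof -
  let ?I = "{i \<in> {..<n}. (T ^^ i) x \<in> B}"
  have "(\<lambda>i. (T ^^ i) x) \<in> measurable (uniform_count_measure {..<n}) borel"
    by (simp add: measurable_def space_uniform_count_measure sets_uniform_count_measure)
  then have "emeasure (empirical_measure T n x) B = emeasure (uniform_count_measure {..<n}) ?I"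
    unfolding empirical_measure_def using B
    by (simp add: emeasure_distr space_uniform_count_measure Int_def conj_commute)
  also have "\<dots> = of_nat (card ?I) / of_nat n"
    using \<open>n > 0\<close>
    by (subst emeasure_uniform_count_measure)
      (auto simp: divide_ennreal ennreal_of_nat_eq_real_of_nat)
  also have "of_nat (card ?I) = (\<Sum>i<n. indicator B ((T ^^ i) x) :: ennreal)"
    by (simp add: indicator_def sum.If_cases Int_def)
  also have "\<dots> = (\<Sum>i<n. emeasure (return borel ((T ^^ i) x)) B)"
    using B by simp
  finally show ?thesis .
qed

text \<open>Accumulation points of the sequence of empirical measures (not merely of its range).\<close>

definition limit_measures :: "('a::topological_space \<Rightarrow> 'a) \<Rightarrow> 'a \<Rightarrow> 'a measure set" where
  "limit_measures T x = {\<nu> \<in> prob_measures.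
    \<forall>W. openin weak_star W \<and> \<nu> \<in> W \<longrightarrow> (\<exists>\<^sub>F n in sequentially. empirical_measure T n x \<in> W)}"

definition basin ::
  "(nat \<Rightarrow> 'a::topological_space \<Rightarrow>\<^sub>C real) \<Rightarrow> ('a \<Rightarrow> 'a) \<Rightarrow> 'a measure \<Rightarrow> real \<Rightarrow> 'a set" where
  "basin F T \<mu> \<epsilon> = {x. (INF \<nu>\<in>limit_measures T x. rho F \<mu> \<nu>) \<le> \<epsilon>}"

definition M_dense ::
  "(nat \<Rightarrow> 'a::topological_space \<Rightarrow>\<^sub>C real) \<Rightarrow> ('a \<Rightarrow> 'a) \<Rightarrow> 'a measure set" where
  "M_dense F T = {\<mu> \<in> invariant_measures T. \<forall>\<epsilon>>0. dense (basin F T \<mu> \<epsilon>)}"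

definition M_Trans :: "('a::topological_space \<Rightarrow> 'a) \<Rightarrow> 'a measure set" where
  "M_Trans T = (\<Union>y\<in>Trans T. limit_measures T y)"


section \<open>Birkhoff averages\<close>

definition lower_average :: "('a::topological_space \<Rightarrow> 'a) \<Rightarrow> ('a \<Rightarrow>\<^sub>C real) \<Rightarrow> 'a \<Rightarrow> ereal" where
  "lower_average T f x = liminf (\<lambda>n. ereal ((\<Sum>i<n. f ((T ^^ i) x)) / real n))"

definition upper_average :: "('a::topological_space \<Rightarrow> 'a) \<Rightarrow> ('a \<Rightarrow>\<^sub>C real) \<Rightarrow> 'a \<Rightarrow> ereal" where
  "upper_average T f x = limsup (\<lambda>n. ereal ((\<Sum>i<n. f ((T ^^ i) x)) / real n))"

definition irregular_set :: "('a::topological_space \<Rightarrow> 'a) \<Rightarrow> ('a \<Rightarrow>\<^sub>C real) \<Rightarrow> 'a set" where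
  "irregular_set T f = {x. lower_average T f x \<noteq> upper_average T f x}"

definition residually_irregular :: "('a::topological_space \<Rightarrow> 'a) \<Rightarrow> ('a \<Rightarrow>\<^sub>C real) set" where
  "residually_irregular T = {f. residual (irregular_set T f)}"


section \<open>Manifolds and physical-like measures\<close>

text \<open>
  A differentiable structure on the whole type \<open>'a\<close>, modelled on \<open>'e\<close>: charts are pairs of an
  open domain and a map, and coordinate changes are of class \<open>C\<^sup>1\<close>, the regularity at which
  Lebesgue measure makes sense up to a positive continuous density.
\<close>

definition C1_on :: "'e::euclidean_space set \<Rightarrow> ('e \<Rightarrow> 'e) \<Rightarrow> bool" where
  "C1_on W h \<longleftrightarrow> (\<exists>D :: 'e \<Rightarrow> 'e \<Rightarrow>\<^sub>L 'e.
    continuous_on W D \<and> (\<forall>y\<in>W. (h has_derivative blinfun_apply (D y)) (at y)))"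

definition C1_atlas :: "('a::topological_space set \<times> ('a \<Rightarrow> 'e::euclidean_space)) set \<Rightarrow> bool" where
  "C1_atlas A \<longleftrightarrow>
    (\<Union>(U, \<phi>)\<in>A. U) = UNIV \<and>
    (\<forall>(U, \<phi>)\<in>A. open U \<and> open (\<phi> ` U) \<and> homeomorphism U (\<phi> ` U) \<phi> (inv_into U \<phi>)) \<and>
    (\<forall>(U, \<phi>)\<in>A. \<forall>(V, \<psi>)\<in>A. C1_on (\<phi> ` (U \<inter> V)) (\<psi> \<circ> inv_into U \<phi>))"

text \<open>
  Borel measures given in every chart by a positive continuous density with respect to Lebesgue
  measure on \<open>'e\<close>. Riemannian volumes are of this form, and all such measures have the same
  null sets.
\<close>

definition manifold_lebesgue ::
  "('a::topological_space set \<times> ('a \<Rightarrow> 'e::euclidean_space)) set \<Rightarrow> 'a measure \<Rightarrow> bool" where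
  "manifold_lebesgue A m \<longleftrightarrow>
    sets m = sets borel \<and>
    (\<forall>(U, \<phi>)\<in>A. \<exists>g :: 'e \<Rightarrow> real.
      continuous_on (\<phi> ` U) g \<and> (\<forall>y\<in>\<phi> ` U. g y > 0) \<and>
      (\<forall>B\<in>sets borel. B \<subseteq> U \<longrightarrow>
        emeasure m B = (\<integral>\<^sup>+ y\<in>\<phi> ` B. ennreal (g y) \<partial>lborel)))"

definition physical_like ::
  "(nat \<Rightarrow> 'a::topological_space \<Rightarrow>\<^sub>C real) \<Rightarrow> ('a \<Rightarrow> 'a) \<Rightarrow> 'a measure \<Rightarrow> 'a measure set" where
  "physical_like F T m = {\<mu> \<in> prob_measures. \<forall>\<epsilon>>0. emeasure m (basin F T \<mu> \<epsilon>) > 0}"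

end

theory Submission
  imports Defs
begin

text \<open>
  The set of limit measures of a point is closed and does not change along its orbit. For a
  point with a dense orbit, every limit measure therefore has dense basins
  (\<open>M_Trans_dense_basin\<close>). The converse is a Baire argument
  (\<open>residual_all_dense_basin_measures\<close>): if all basins of \<open>\<mu>\<close> are
  dense, then the empirical measures of a generic point come arbitrarily close to
  \<open>\<mu>\<close> infinitely often. As the weak* topology has a countable base, a single
  residual set of points with dense orbits serves all such \<open>\<mu>\<close> simultaneously.
  For a point of that set the limit measures, the measures with dense basins and
  \<^const>\<open>M_Trans\<close> coincide; \<open>generic_points\<close> is the set of all such
  points, and it is the residual invariant set sought.

  Each lower or upper Birkhoff average is the infimum or supremum of the integrals over the
  limit measures of the point (\<open>lower_average_eq_INF\<close>), so the claims about
  averages, and the description of the functions that are irregular on a residual set, reduce to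
  the equality of the limit measures with \<^const>\<open>M_Trans\<close>: those functions are
  the ones that separate two measures of \<^const>\<open>M_Trans\<close>, an open condition that
  is dense as soon as one function satisfies it.

  For physical-like measures (\<open>physical_like_exists\<close>), compactness yields a measure
  whose basins have positive Lebesgue measure inside every neighbourhood of a point with dense
  orbit. Its basins are then dense, so it belongs to \<^const>\<open>M_Trans\<close>.

  All of this rests on the weak* sequential compactness of the probability measures on a compact
  metric space (\<open>prob_measures_seq_compact\<close>). It is derived from Helly's selection
  theorem on the real line: the space is encoded by real numbers, with digits that tell in which
  sets of a countable base a point lies.
\<close>

section \<open>Encoding a compact metric space by real numbers\<close>

text \<open>
  A compact metric space is totally bounded; the balls of radius 1/n about finite 1/n-nets form
  a base.
\<close>

lemma (in Metric_space) compact_space_imp_second_countable: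
  assumes "compact_space mtopology"
  shows "second_countable mtopology"
proof -
  have "mtotally_bounded M"
    using assms compactin_imp_mtotally_bounded compact_space_def by fastforce
  then have "\<forall>n. \<exists>K. finite K \<and> K \<subseteq> M \<and> M \<subseteq> (\<Union>x\<in>K. mball x (1 / real (Suc n)))"
    unfolding mtotally_bounded_def by simp
  then obtain K where K: "\<And>n. finite (K n)" "\<And>n. K n \<subseteq> M"
      "\<And>n. M \<subseteq> (\<Union>x\<in>K n. mball x (1 / real (Suc n)))"
    by metis
  define B where "B = (\<Union>n. (\<lambda>x. mball x (1 / real (Suc n))) ` K n)"
  have "\<exists>V\<in>B. x \<in> V \<and> V \<subseteq> U" if U: "openin mtopology U" "x \<in> U" for U x
  proof -
    obtain r where r: "r > 0" "mball x r \<subseteq> U" and "x \<in> M"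
      using U unfolding openin_mtopology by blast
    obtain n where n: "1 / real (Suc n) < r / 2"
      using reals_Archimedean[of "r / 2"] r(1) by (auto simp: inverse_eq_divide)
    obtain a where a: "a \<in> K n" "x \<in> mball a (1 / real (Suc n))"
      using K(3)[of n] \<open>x \<in> M\<close> by blast
    have "mball a (1 / real (Suc n)) \<subseteq> mball x r"
    proof
      fix z assume z: "z \<in> mball a (1 / real (Suc n))"
      then have "d x z \<le> d x a + d a z" using a \<open>x \<in> M\<close> by (intro triangle) auto
      then show "z \<in> mball x r" using z a n by (auto simp: commute)
    qed
    then show ?thesis using a r unfolding B_def by blast
  qed
  moreover have "countable B" "\<forall>V\<in>B. openin mtopology V"
    using K(1) by (auto simp: B_def countable_finite)
  ultimately show ?thesis unfolding second_countable_def by metis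
qed

lemma compact_metric_countable_base:
  assumes "compact (UNIV :: 'a::metric_space set)"
  obtains \<B> :: "'a::metric_space set set" where "countable \<B>" "\<And>V. V \<in> \<B> \<Longrightarrow> open V"
    "\<And>U x. open U \<Longrightarrow> x \<in> U \<Longrightarrow> \<exists>V\<in>\<B>. x \<in> V \<and> V \<subseteq> U"
proof -
  have "second_countable (euclidean :: 'a topology)"
    using Met_TC.compact_space_imp_second_countable[where ?'a = 'a] assms
    by (simp add: compact_space_def)
  then show ?thesis
    unfolding second_countable_def using that by (auto simp flip: open_openin)
qed

lemma continuous_on_compact_bcontfun:
  fixes f :: "'a::topological_space \<Rightarrow> real"
  assumes "compact (UNIV :: 'a set)" "continuous_on UNIV f"
  obtains g :: "'a \<Rightarrow>\<^sub>C real" where "apply_bcontfun g = f"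
  using assms compact_continuous_image[OF assms(2,1)]
  by (metis (mono_tags) bcontfun_def Bcontfun_inverse mem_Collect_eq compact_imp_bounded)

text \<open>
  A point of the Cantor set rescaled to the interval [0, 1/2]; the digits are 0 and 1 instead of
  0 and 2.
\<close>

definition ternary_code :: "(nat \<Rightarrow> bool) \<Rightarrow> real" where
  "ternary_code b = (\<Sum>k. of_bool (b k) * (1 / 3) ^ Suc k)"

lemma summable_ternary_code: "summable (\<lambda>k. of_bool (b k) * (1 / 3 :: real) ^ Suc k)"
  by (rule summable_comparison_test'[where g="\<lambda>k. (1 / 3 :: real) ^ k" and N=0])
    (auto intro!: summable_geometric mult_left_le_one_le)

lemma ternary_code_bounds: "ternary_code b \<in> {0..1}"
proof -
  have "ternary_code b \<le> (\<Sum>k. 1 / 3 * (1 / 3) ^ k)"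
    unfolding ternary_code_def using summable_ternary_code[of b]
    by (intro suminf_le summable_mult summable_geometric) auto
  also have "\<dots> = 1 / 2"
    by (subst suminf_mult) (auto simp: suminf_geometric)
  finally show ?thesis
    unfolding ternary_code_def using suminf_nonneg[OF summable_ternary_code, of b] by auto
qed

text \<open>
  The first digit in which two codes differ outweighs all later digits together, so close codes
  share their initial digits.
\<close>

lemma ternary_code_close_imp_digits_eq:
  assumes close: "\<bar>ternary_code b - ternary_code c\<bar> < (1 / 3) ^ m / 2" and "i < m"
  shows "b i = c i"
proof (rule ccontr)
  assume "b i \<noteq> c i"
  define j where "j = (LEAST i. b i \<noteq> c i)"
  have j: "b j \<noteq> c j"
    unfolding j_def using \<open>b i \<noteq> c i\<close> by (rule LeastI)
  have less: "b i = c i" if "i < j" for i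
    using not_less_Least[OF that[unfolded j_def]] by blast
  have "j < m"
    using Least_le[of "\<lambda>i. b i \<noteq> c i", OF \<open>b i \<noteq> c i\<close>] \<open>i < m\<close> unfolding j_def by simp
  define a where "a k = (of_bool (b k) - of_bool (c k)) * (1 / 3 :: real) ^ Suc k" for k
  have a: "a = (\<lambda>k. of_bool (b k) * (1 / 3) ^ Suc k - of_bool (c k) * (1 / 3) ^ Suc k)"
    by (simp add: a_def[abs_def] left_diff_distrib diff_divide_distrib)
  have sum_a: "summable a"
    unfolding a by (intro summable_diff summable_ternary_code)
  have diff: "ternary_code b - ternary_code c = suminf a"
    unfolding ternary_code_def a by (intro suminf_diff summable_ternary_code)
  have "suminf a = (\<Sum>k. a (k + Suc j)) + (\<Sum>k<Suc j. a k)"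
    by (rule suminf_split_initial_segment[OF sum_a])
  also have "(\<Sum>k<Suc j. a k) = a j"
    using less by (simp add: a_def)
  finally have split: "suminf a = (\<Sum>k. a (k + Suc j)) + a j" .
  have "norm (\<Sum>k. a (k + Suc j)) \<le> (\<Sum>k. (1 / 3) ^ (j + 2) * (1 / 3) ^ k)"
    by (rule norm_suminf_le)
      (auto simp: a_def abs_mult power_add of_bool_def intro!: summable_mult summable_geometric)
  also have "\<dots> = (1 / 3) ^ Suc j / 2"
    by (subst suminf_mult) (auto simp: suminf_geometric power_add)
  finally have "\<bar>suminf a\<bar> \<ge> (1 / 3) ^ Suc j / 2"
    using j unfolding split by (auto simp: a_def of_bool_def split: if_splits)
  moreover have "(1 / 3 :: real) ^ m \<le> (1 / 3) ^ Suc j"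
    using \<open>j < m\<close> by (intro power_decreasing) auto
  ultimately show False using close unfolding diff by simp
qed

text \<open>
  A compact metric space can be moved to the real line by a Borel map that loses no continuous
  function: the digits of the code of a point record to which sets of a countable base the point
  belongs. The code need not be continuous, but its inverse is uniformly continuous on the
  image. So a continuous function on the space becomes a uniformly continuous function on the
  set of codes, which extends to the closure and then, by Tietze, to the whole line.
\<close>

lemma compact_metric_real_coding:
  assumes cpt: "compact (UNIV :: 'a::metric_space set)"
  obtains c :: "'a::metric_space \<Rightarrow> real" where "c \<in> borel_measurable borel" "\<And>x. c x \<in> {0..1}"
    "\<And>f :: 'a::metric_space \<Rightarrow> real. continuous_on UNIV f \<Longrightarrow>
        \<exists>g B. continuous_on UNIV g \<and> (\<forall>t. \<bar>g t\<bar> \<le> B) \<and> (\<forall>x. g (c x) = f x)"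
proof -
  obtain \<B> :: "'a set set" where \<B>: "countable \<B>" "\<And>V. V \<in> \<B> \<Longrightarrow> open V"
    "\<And>U x. open U \<Longrightarrow> x \<in> U \<Longrightarrow> \<exists>V\<in>\<B>. x \<in> V \<and> V \<subseteq> U"
    by (rule compact_metric_countable_base[OF cpt]) blast
  have "\<B> \<noteq> {}" using \<B>(3)[of UNIV undefined] by auto
  define U where "U = from_nat_into \<B>"
  have rangeU: "range U = \<B>"
    unfolding U_def by (rule range_from_nat_into[OF \<open>\<B> \<noteq> {}\<close> \<B>(1)])
  define c where "c x = ternary_code (\<lambda>k. x \<in> U k)" for x
  have openU: "open (U k)" for k using \<B>(2) rangeU by auto
  \<comment> \<open>The inverse of the code is uniformly continuous: finitely many base sets of small diameter
    cover the space, and close codes agree in the digits that belong to these sets.\<close>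
  have c_close: "\<exists>\<delta>>0. \<forall>x y. \<bar>c x - c y\<bar> < \<delta> \<longrightarrow> dist x y < \<epsilon>" if "\<epsilon> > 0" for \<epsilon>
  proof -
    have "\<exists>k. x \<in> U k \<and> U k \<subseteq> ball x (\<epsilon> / 2)" for x
      using \<B>(3)[of "ball x (\<epsilon> / 2)" x] \<open>\<epsilon> > 0\<close> by (auto simp flip: rangeU)
    then obtain k where k: "\<And>x. x \<in> U (k x)" "\<And>x. U (k x) \<subseteq> ball x (\<epsilon> / 2)" by metis
    obtain C where C: "finite C" "UNIV \<subseteq> (\<Union>x\<in>C. U (k x))"
    proof (rule compactE_image[OF cpt, of UNIV "\<lambda>x. U (k x)"])
      show "open (U (k x))" for x by (rule openU)
      show "UNIV \<subseteq> (\<Union>x. U (k x))" using k(1) by auto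
    qed auto
    define m where "m = Suc (Max (k ` C))"
    have "dist x y < \<epsilon>" if "\<bar>c x - c y\<bar> < (1 / 3) ^ m / 2" for x y
    proof -
      obtain z where z: "z \<in> C" "x \<in> U (k z)" using C(2) by blast
      then have "k z < m" unfolding m_def using C(1) by (simp add: less_Suc_eq_le)
      then have "y \<in> U (k z)"
        using ternary_code_close_imp_digits_eq[OF that[unfolded c_def]] z by blast
      then have "dist z x < \<epsilon> / 2" "dist z y < \<epsilon> / 2" using z k(2)[of z] by auto
      then show ?thesis by (metis dist_commute dist_triangle_half_l)
    qed
    then show ?thesis by (intro exI[of _ "(1 / 3) ^ m / 2"]) auto
  qed
  show ?thesis
  proof
    show "c \<in> borel_measurable borel"
    proof -
      have [measurable]: "U k \<in> sets borel" for k using openU by simp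
      show ?thesis unfolding c_def ternary_code_def by measurable
    qed
    show "c x \<in> {0..1}" for x unfolding c_def by (rule ternary_code_bounds)
    fix f :: "'a \<Rightarrow> real" assume f: "continuous_on UNIV f"
    then have uf: "uniformly_continuous_on UNIV f"
      using cpt by (rule compact_uniformly_continuous)
    obtain B where B: "\<And>x. \<bar>f x\<bar> \<le> B"
      using compact_imp_bounded[OF compact_continuous_image[OF f cpt]] by (auto simp: bounded_iff)
    have "B \<ge> 0" using B[of undefined] by linarith
    have "inj c"
    proof (rule injI, rule ccontr)
      fix x y assume "c x = c y" "x \<noteq> y"
      then show False using c_close[of "dist x y"] by force
    qed
    define h where "h = f \<circ> inv c"
    have h: "h (c x) = f x" for x using \<open>inj c\<close> by (simp add: h_def)
    have "uniformly_continuous_on (range c) h"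
    proof (unfold uniformly_continuous_on_def, intro allI impI)
      fix e :: real assume "e > 0"
      then obtain d where d: "d > 0" "\<And>x y. dist x y < d \<Longrightarrow> dist (f x) (f y) < e"
        using uf unfolding uniformly_continuous_on_def by (metis UNIV_I dist_commute)
      obtain \<delta> where "\<delta> > 0" "\<And>x y. \<bar>c x - c y\<bar> < \<delta> \<Longrightarrow> dist x y < d"
        using c_close[OF d(1)] by blast
      then show "\<exists>d>0. \<forall>x\<in>range c. \<forall>x'\<in>range c. dist x' x < d \<longrightarrow> dist (h x') (h x) < e"
        using d by (auto simp: h dist_real_def intro!: exI[of _ \<delta>])
    qed
    then obtain h' where h': "uniformly_continuous_on (closure (range c)) h'"
        "\<And>t. t \<in> range c \<Longrightarrow> h t = h' t"
      by (rule uniformly_continuous_on_extension_on_closure) blast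
    have cont: "continuous_on (closure (range c)) h'"
      using h'(1) by (rule uniformly_continuous_imp_continuous)
    have bound: "norm (h' t) \<le> B" if "t \<in> closure (range c)" for t
      using that B h' h by (intro continuous_on_closure_norm_le[OF cont]) auto
    obtain g where "continuous_on UNIV g" "\<And>t. t \<in> closure (range c) \<Longrightarrow> g t = h' t"
        "\<And>t. t \<in> UNIV \<Longrightarrow> norm (g t) \<le> B"
    proof (rule Tietze[OF cont _ \<open>B \<ge> 0\<close>, of UNIV])
      show "closedin (top_of_set UNIV) (closure (range c))"
        by (simp flip: closed_closedin)
    qed (use bound in auto)
    then show "\<exists>g B. continuous_on UNIV g \<and> (\<forall>t. \<bar>g t\<bar> \<le> B) \<and> (\<forall>x. g (c x) = f x)"
      using h'(2) h closure_subset[of "range c"]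
      by (intro exI[of _ g] exI[of _ B]) (auto simp: subset_iff)
  qed
qed

section \<open>Weak* compactness of the probability measures\<close>

lemma prob_measuresD:
  assumes "\<mu> \<in> prob_measures"
  shows "prob_space \<mu>" "sets \<mu> = sets borel" "space \<mu> = UNIV"
  using assms sets_eq_imp_space_eq[of \<mu> borel] by (auto simp: prob_measures_def)

lemma abs_bcontfun_le: "\<bar>apply_bcontfun f x\<bar> \<le> norm f" for f :: "'a::topological_space \<Rightarrow>\<^sub>C real"
  using norm_bounded[of f x] by simp

lemma integrable_bcontfun:
  fixes f :: "'a::topological_space \<Rightarrow>\<^sub>C real"
  assumes "\<mu> \<in> prob_measures"
  shows "integrable \<mu> f"
proof -
  interpret prob_space \<mu> using assms by (rule prob_measuresD)
  have "apply_bcontfun f \<in> borel_measurable \<mu>"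
    by (simp add: measurable_cong_sets[OF prob_measuresD(2)[OF assms] refl]
        borel_measurable_continuous_onI)
  then show ?thesis
    by (intro integrable_const_bound[where B="norm f"]) (auto intro: abs_bcontfun_le)
qed

lemma integral_bcontfun_bound:
  fixes f :: "'a::topological_space \<Rightarrow>\<^sub>C real"
  assumes "\<mu> \<in> prob_measures"
  shows "\<bar>\<integral>x. f x \<partial>\<mu>\<bar> \<le> norm f"
proof -
  interpret prob_space \<mu> using assms by (rule prob_measuresD)
  have "\<bar>\<integral>x. f x \<partial>\<mu>\<bar> \<le> (\<integral>x. norm (f x) \<partial>\<mu>)"
    using integral_norm_bound[of \<mu> f] by simp
  also have "\<dots> \<le> norm f"
    using integrable_bcontfun[OF assms, of f]
    by (intro integral_le_const) (auto intro: abs_bcontfun_le)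
  finally show ?thesis .
qed

lemma bounded_linear_integral_bcontfun:
  assumes \<mu>: "\<mu> \<in> prob_measures"
  shows "bounded_linear (\<lambda>f :: 'a::topological_space \<Rightarrow>\<^sub>C real. \<integral>x. f x \<partial>\<mu>)"
  using integrable_bcontfun[OF \<mu>] integral_bcontfun_bound[OF \<mu>]
  by (intro bounded_linear_intro[where K = 1]) auto

lemma topspace_weak_star: "topspace weak_star = prob_measures"
proof -
  have "prob_measures \<in> {{\<mu> \<in> prob_measures. (\<integral>x. f x \<partial>\<mu>) \<in> U} | (f :: 'a \<Rightarrow>\<^sub>C real) U. open U}"
    by (rule CollectI, rule exI[of _ 0], rule exI[of _ UNIV]) auto
  then show ?thesis
    unfolding weak_star_def topology_generated_by_topspace by (intro equalityI) (blast, blast)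
qed

lemma openin_weak_star_subbasis:
  fixes f :: "'a::topological_space \<Rightarrow>\<^sub>C real"
  assumes "open U"
  shows "openin weak_star {\<mu> \<in> prob_measures. (\<integral>x. f x \<partial>\<mu>) \<in> U}"
  unfolding weak_star_def by (rule topology_generated_by_Basis) (use assms in blast)

lemma limitin_topology_generated_by:
  assumes "x \<in> \<Union>S" "\<And>U. U \<in> S \<Longrightarrow> x \<in> U \<Longrightarrow> \<forall>\<^sub>F i in F. f i \<in> U"
  shows "limitin (topology_generated_by S) f x F"
  unfolding limitin_def topology_generated_by_topspace
proof (intro conjI allI impI assms(1))
  fix U assume "openin (topology_generated_by S) U \<and> x \<in> U"
  then have "generate_topology_on S U" "x \<in> U" by (auto simp: openin_topology_generated_by)
  then show "\<forall>\<^sub>F i in F. f i \<in> U"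
  proof induct
    case (Int a b)
    then show ?case by (auto intro: eventually_conj)
  next
    case (UN K)
    then obtain k where "k \<in> K" "x \<in> k" by blast
    with UN have "\<forall>\<^sub>F i in F. f i \<in> k" by blast
    then show ?case by eventually_elim (use \<open>k \<in> K\<close> in blast)
  qed (auto intro: assms(2))
qed

text \<open>
  Convergence in the weak* topology may be tested on the subbasis that defines it, which turns
  it into convergence of integrals.
\<close>

lemma limitin_weak_star_iff:
  fixes \<mu> :: "'a::topological_space measure"
  assumes "\<mu> \<in> prob_measures" "\<forall>\<^sub>F i in F. \<nu> i \<in> prob_measures"
  shows "limitin weak_star \<nu> \<mu> F \<longleftrightarrow>
    (\<forall>f :: 'a \<Rightarrow>\<^sub>C real. ((\<lambda>i. \<integral>x. f x \<partial>\<nu> i) \<longlongrightarrow> (\<integral>x. f x \<partial>\<mu>)) F)"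
proof (intro iffI allI)
  fix f :: "'a \<Rightarrow>\<^sub>C real" assume lim: "limitin weak_star \<nu> \<mu> F"
  show "((\<lambda>i. \<integral>x. f x \<partial>\<nu> i) \<longlongrightarrow> (\<integral>x. f x \<partial>\<mu>)) F"
  proof (rule topological_tendstoI)
    fix U assume "open U" "(\<integral>x. f x \<partial>\<mu>) \<in> U"
    then have "\<forall>\<^sub>F i in F. \<nu> i \<in> {\<mu> \<in> prob_measures. (\<integral>x. f x \<partial>\<mu>) \<in> U}"
      using lim openin_weak_star_subbasis[of U f] assms(1) unfolding limitin_def by blast
    then show "\<forall>\<^sub>F i in F. (\<integral>x. f x \<partial>\<nu> i) \<in> U" by eventually_elim auto
  qed
next
  assume conv: "\<forall>f :: 'a \<Rightarrow>\<^sub>C real. ((\<lambda>i. \<integral>x. f x \<partial>\<nu> i) \<longlongrightarrow> (\<integral>x. f x \<partial>\<mu>)) F"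
  show "limitin weak_star \<nu> \<mu> F"
    unfolding weak_star_def
  proof (rule limitin_topology_generated_by)
    show "\<mu> \<in> \<Union>{{\<mu> \<in> prob_measures. (\<integral>x. f x \<partial>\<mu>) \<in> U} | (f :: 'a \<Rightarrow>\<^sub>C real) U. open U}"
      using assms(1) topspace_weak_star unfolding weak_star_def topology_generated_by_topspace by blast
    fix W assume "W \<in> {{\<mu> \<in> prob_measures. (\<integral>x. f x \<partial>\<mu>) \<in> U} | (f :: 'a \<Rightarrow>\<^sub>C real) U. open U}" "\<mu> \<in> W"
    then obtain f :: "'a \<Rightarrow>\<^sub>C real" and U where W: "W = {\<mu> \<in> prob_measures. (\<integral>x. f x \<partial>\<mu>) \<in> U}"
        "open U" "(\<integral>x. f x \<partial>\<mu>) \<in> U" by blast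
    have "\<forall>\<^sub>F i in F. (\<integral>x. f x \<partial>\<nu> i) \<in> U"
      using conv W by (auto dest: topological_tendstoD)
    with assms(2) show "\<forall>\<^sub>F i in F. \<nu> i \<in> W" by eventually_elim (auto simp: W)
  qed
qed

text \<open>
  Push the measures forward along the real code. The images live in [0, 1] and are tight, so
  Helly's theorem gives a subsequence that converges weakly on the line. The limit is carried by
  the closure of the set of codes, where decoding is defined, and its image under decoding is
  the limit sought: the integral of a continuous function against it is the integral of the
  extended function on the line.
\<close>

lemma prob_measures_seq_compact:
  fixes \<nu> :: "nat \<Rightarrow> 'a::metric_space measure"
  assumes cpt: "compact (UNIV :: 'a set)" and \<nu>: "\<And>n. \<nu> n \<in> prob_measures"
  obtains \<mu> r where "\<mu> \<in> prob_measures" "strict_mono (r :: nat \<Rightarrow> nat)"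
    "limitin weak_star (\<nu> \<circ> r) \<mu> sequentially"
proof -
  obtain c :: "'a \<Rightarrow> real" where c[measurable]: "c \<in> borel_measurable borel"
    and c01: "\<And>x. c x \<in> {0..1}"
    and ext: "\<And>f :: 'a \<Rightarrow> real. continuous_on UNIV f \<Longrightarrow>
        \<exists>g B. continuous_on UNIV g \<and> (\<forall>t. \<bar>g t\<bar> \<le> B) \<and> (\<forall>x. g (c x) = f x)"
    by (rule compact_metric_real_coding[OF cpt]) blast
  define N where "N n = distr (\<nu> n) borel c" for n
  have c\<nu>: "c \<in> borel_measurable (\<nu> n)" for n
    using c by (simp add: measurable_cong_sets[OF prob_measuresD(2)[OF \<nu>] refl])
  have N: "real_distribution (N n)" for n
    unfolding N_def real_distribution_def real_distribution_axioms_def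
    using prob_space.prob_space_distr[OF prob_measuresD(1)[OF \<nu>] c\<nu>] by simp
  have "tight N"
    unfolding tight_def
  proof (intro conjI allI impI N)
    fix e :: real assume "e > 0"
    have "measure (N n) {-1<..2} = 1" for n
    proof -
      interpret prob_space "\<nu> n" by (rule prob_measuresD[OF \<nu>])
      have "-1 < c x \<and> c x \<le> 2" for x using c01[of x] by auto
      then have "c -` {-1<..2} = UNIV" by auto
      then show ?thesis
        unfolding N_def using c\<nu>[of n] prob_measuresD(3)[OF \<nu>, of n] prob_space
        by (subst measure_distr) auto
    qed
    with \<open>e > 0\<close> show "\<exists>a b. a < b \<and> (\<forall>n. measure (N n) {a<..b} > 1 - e)"
      by (intro exI[of _ "-1"] exI[of _ 2]) auto
  qed
  from tight_imp_convergent_subsubsequence[OF this strict_mono_id]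
  obtain r L where r: "strict_mono (r :: nat \<Rightarrow> nat)" and L: "real_distribution L"
    and conv: "weak_conv_m (N \<circ> r) L"
    by auto
  interpret L: real_distribution L by (rule L)
  have conv_int: "(\<lambda>n. integral\<^sup>L (N (r n)) g) \<longlonglongrightarrow> integral\<^sup>L L g"
    if "continuous_on UNIV g" "\<And>t. \<bar>g t\<bar> \<le> B" for g :: "real \<Rightarrow> real" and B
    using weak_conv_imp_integral_bdd_continuous_conv[OF _ L conv, of g B] N that
    by (auto simp: continuous_on_eq_continuous_at)
  have int_N: "integral\<^sup>L (N n) g = (\<integral>x. g (c x) \<partial>\<nu> n)" if "continuous_on UNIV g" for n and g :: "real \<Rightarrow> real"
    unfolding N_def using c\<nu> borel_measurable_continuous_onI[OF that] by (rule integral_distr)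

  define K where "K = closure (range c)"
  have [measurable]: "K \<in> sets borel" by (simp add: K_def)
  \<comment> \<open>The limit charges only the closure of the codes: test against the distance to it.\<close>
  have LK: "AE t in L. t \<in> K"
  proof -
    define g where "g t = min 1 (infdist t K)" for t
    have g: "continuous_on UNIV g" "\<And>t. \<bar>g t\<bar> \<le> 1"
      unfolding g_def by (auto intro!: continuous_intros simp: infdist_nonneg)
    have "g (c x) = 0" for x
      unfolding g_def K_def using closure_subset[of "range c"] by (subst infdist_zero) auto
    then have "(\<lambda>n. 0) \<longlonglongrightarrow> integral\<^sup>L L g"
      using conv_int[OF g] int_N[OF g(1)] by simp
    then have "integral\<^sup>L L g = 0" by (simp add: LIMSEQ_const_iff)
    moreover have "integrable L g"
      using g borel_measurable_continuous_onI[OF g(1)] by (intro L.integrable_const_bound[of _ 1]) auto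
    ultimately have AE0: "AE t in L. g t = 0"
      using integral_nonneg_eq_0_iff_AE[of L g] by (auto simp: g_def infdist_nonneg)
    have zero: "t \<in> K" if "g t = 0" for t
    proof -
      have "infdist t K = 0" using that by (auto simp: g_def min_def split: if_splits)
      then show ?thesis
        using in_closed_iff_infdist_zero[of K t] by (simp add: K_def)
    qed
    show ?thesis using AE0 by eventually_elim (rule zero)
  qed
  \<comment> \<open>Decoding. A point of the closure is a limit of codes of a convergent sequence in the space; for
    a continuous function, the extension evaluated at the point is the value at the limit of that
    sequence. All these identities hold for one and the same decoded point.\<close>
  have "\<exists>x. \<forall>(f :: 'a \<Rightarrow> real) g. continuous_on UNIV f \<longrightarrow> continuous_on UNIV g \<longrightarrow> (\<forall>x. g (c x) = f x) \<longrightarrow> f x = g t"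
    if "t \<in> K" for t :: real
  proof -
    have "\<exists>y. (\<forall>n. y n \<in> range c) \<and> y \<longlonglongrightarrow> t"
      using that unfolding K_def closure_sequential .
    then obtain y where y: "\<And>n. y n \<in> range c" "y \<longlonglongrightarrow> t" by auto
    define z where "z n = inv c (y n)" for n
    have z: "y n = c (z n)" for n
      unfolding z_def by (rule f_inv_into_f[OF y(1), symmetric])
    obtain x s where s: "strict_mono (s :: nat \<Rightarrow> nat)" "(z \<circ> s) \<longlonglongrightarrow> x"
      using cpt[unfolded compact_eq_seq_compact_metric seq_compact_def, rule_format, of z] by auto
    have "f x = g t"
      if f: "continuous_on UNIV f" and g: "continuous_on UNIV g" and "\<forall>x. g (c x) = f x"
      for f :: "'a \<Rightarrow> real" and g
    proof -
      have "(\<lambda>n. f ((z \<circ> s) n)) \<longlonglongrightarrow> f x"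
        using f s(2) continuous_on_tendsto_compose[of UNIV f "z \<circ> s" x] by simp
      moreover have "(\<lambda>n. g ((y \<circ> s) n)) \<longlonglongrightarrow> g t"
        using g LIMSEQ_subseq_LIMSEQ[OF y(2) s(1)] continuous_on_tendsto_compose[of UNIV g "y \<circ> s" t] by simp
      ultimately show ?thesis
        using that(3) z by (auto simp: o_def intro: LIMSEQ_unique)
    qed
    then show ?thesis by blast
  qed
  then obtain \<pi> where \<pi>: "\<And>t (f :: 'a \<Rightarrow> real) g. t \<in> K \<Longrightarrow> continuous_on UNIV f \<Longrightarrow> continuous_on UNIV g \<Longrightarrow>
      (\<forall>x. g (c x) = f x) \<Longrightarrow> f (\<pi> t) = g t"
    by metis
  \<comment> \<open>Off the closure of the codes, a null set of the limit, the value is arbitrary.\<close>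
  define p where "p t = (if t \<in> K then \<pi> t else undefined)" for t
  \<comment> \<open>An open set is where the distance to its complement is positive, so its preimage under
    decoding is, on the closure of the codes, where an extended continuous function is positive.\<close>
  have [measurable]: "p \<in> borel_measurable borel"
  proof (rule borel_measurableI)
    fix U :: "'a set" assume "open U"
    show "p -` U \<inter> space borel \<in> sets borel"
    proof (cases "U = UNIV")
      case False
      define f where "f x = infdist x (- U)" for x
      have f: "continuous_on UNIV f" unfolding f_def by (intro continuous_intros)
      have fU: "x \<in> U \<longleftrightarrow> f x > 0" for x
        using in_closed_iff_infdist_zero[of "- U" x] False \<open>open U\<close> infdist_nonneg[of x "- U"]
        unfolding f_def by (auto simp: less_le)
      obtain g where g: "continuous_on UNIV g" "\<forall>x. g (c x) = f x" using ext[OF f] by blast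
      have [measurable]: "g \<in> borel_measurable borel" using g(1) by (rule borel_measurable_continuous_onI)
      have "p -` U = {t. if t \<in> K then g t > 0 else undefined \<in> U}"
        using \<pi>[OF _ f g] fU by (auto simp: p_def)
      also have "\<dots> \<in> sets borel" by measurable
      finally show ?thesis by simp
    qed auto
  qed
  define \<mu> where "\<mu> = distr L borel p"
  have \<mu>: "\<mu> \<in> prob_measures"
    unfolding \<mu>_def prob_measures_def by (auto intro!: L.prob_space_distr)
  have "limitin weak_star (\<nu> \<circ> r) \<mu> sequentially"
  proof (subst limitin_weak_star_iff[OF \<mu>])
    show "\<forall>\<^sub>F i in sequentially. (\<nu> \<circ> r) i \<in> prob_measures" using \<nu> by simp
    show "\<forall>f :: 'a \<Rightarrow>\<^sub>C real. (\<lambda>i. \<integral>x. f x \<partial>(\<nu> \<circ> r) i) \<longlonglongrightarrow> (\<integral>x. f x \<partial>\<mu>)"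
    proof
      fix f :: "'a \<Rightarrow>\<^sub>C real"
      have f: "continuous_on UNIV (apply_bcontfun f)" by simp
      obtain g B where g: "continuous_on UNIV g" "\<And>t. \<bar>g t\<bar> \<le> B" "\<forall>x. g (c x) = f x"
        using ext[OF f] by blast
      have [measurable]: "apply_bcontfun f \<in> borel_measurable borel" "g \<in> borel_measurable borel"
        using g(1) f by (auto intro: borel_measurable_continuous_onI)
      have "(\<integral>x. f x \<partial>\<mu>) = (\<integral>t. f (p t) \<partial>L)"
        unfolding \<mu>_def by (rule integral_distr) measurable
      also have "\<dots> = integral\<^sup>L L g"
      proof (rule integral_cong_AE)
        show "AE t in L. f (p t) = g t"
          using LK by eventually_elim (use \<pi>[OF _ f g(1,3)] in \<open>simp add: p_def\<close>)
      qed measurable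
      finally have "(\<integral>x. f x \<partial>\<mu>) = integral\<^sup>L L g" .
      then show "(\<lambda>i. \<integral>x. f x \<partial>(\<nu> \<circ> r) i) \<longlonglongrightarrow> (\<integral>x. f x \<partial>\<mu>)"
        using conv_int[OF g(1,2)] int_N[OF g(1)] g(3) by simp
    qed
  qed
  with \<mu> r show ?thesis by (rule that)
qed

section \<open>Residual sets\<close>

lemma dense_iff_meets_open: "dense S \<longleftrightarrow> (\<forall>U. open U \<longrightarrow> U \<noteq> {} \<longrightarrow> S \<inter> U \<noteq> {})"
proof -
  have "dense S \<longleftrightarrow> (\<forall>U. open U \<longrightarrow> U \<noteq> {} \<longrightarrow> U \<inter> closure S \<noteq> {})"
    unfolding dense_def by (metis Int_UNIV_right closed_closure closure_subset compl_le_swap1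
        disjoint_eq_subset_Compl open_Compl order_refl Compl_UNIV_eq double_compl)
  then show ?thesis by (metis open_Int_closure_eq_empty inf_commute)
qed

lemma dense_superset: "dense S \<Longrightarrow> S \<subseteq> S' \<Longrightarrow> dense S'"
  unfolding dense_iff_meets_open by blast

text \<open>
  Baire's theorem, in the form in which generic sets are produced below.
\<close>

lemma compact_metric_residualI:
  fixes S :: "'a::metric_space set"
  assumes cpt: "compact (UNIV :: 'a set)" and "countable \<G>"
    and \<G>: "\<And>G. G \<in> \<G> \<Longrightarrow> open G" "\<And>G. G \<in> \<G> \<Longrightarrow> dense G" and "\<Inter>\<G> \<subseteq> S"
  shows "residual S"
  unfolding residual_def
proof (intro exI conjI)
  define U where "U = from_nat_into (insert UNIV \<G>)"
  have "range U = insert UNIV \<G>"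
    unfolding U_def using \<open>countable \<G>\<close> by (intro range_from_nat_into) auto
  then have eq: "\<Inter>\<G> = \<Inter>(range U)" by auto
  have "open (U n)" for n
  proof -
    have "U n \<in> insert UNIV \<G>" using \<open>range U = insert UNIV \<G>\<close> by blast
    then show ?thesis using \<G>(1) by auto
  qed
  then show "gdelta (\<Inter>\<G>)" unfolding eq by (intro gdelta.intros)
  have "Met_TC.mcomplete TYPE('a)"
    using cpt by (intro Met_TC.compact_space_imp_mcomplete) (simp add: compact_space_def)
  then have "completely_metrizable_space (euclidean :: 'a topology)"
    using Met_TC.completely_metrizable_space_mtopology[where ?'a = 'a] by simp
  then have "euclidean closure_of \<Inter>\<G> = topspace euclidean"
    using \<G> \<open>countable \<G>\<close> by (intro Baire_category) (auto simp: dense_def simp flip: open_openin)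
  then show "dense (\<Inter>\<G>)" by (simp add: dense_def)
  show "\<Inter>\<G> \<subseteq> S" by fact
qed

lemma residual_Int_nonempty:
  fixes A B :: "'a::metric_space set"
  assumes cpt: "compact (UNIV :: 'a set)" and "residual A" "residual B"
  shows "A \<inter> B \<noteq> {}"
proof -
  have "\<exists>G :: nat \<Rightarrow> 'a set. (\<forall>n. open (G n)) \<and> (\<forall>n. dense (G n)) \<and> \<Inter>(range G) \<subseteq> S"
    if S: "residual S" for S :: "'a set"
  proof -
    obtain G where "gdelta G" "dense G" "G \<subseteq> S" using S unfolding residual_def by blast
    from this(1) obtain H :: "nat \<Rightarrow> 'a set" where H: "G = \<Inter>(range H)" "\<And>n. open (H n)"
      by (rule gdelta.cases) blast
    have "dense (H n)" for n by (rule dense_superset[OF \<open>dense G\<close>]) (auto simp: H(1))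
    with H \<open>G \<subseteq> S\<close> show ?thesis by blast
  qed
  from this[OF assms(2)] this[OF assms(3)] obtain G H :: "nat \<Rightarrow> 'a set"
    where G: "\<And>n. open (G n)" "\<And>n. dense (G n)" "\<Inter>(range G) \<subseteq> A"
      and H: "\<And>n. open (H n)" "\<And>n. dense (H n)" "\<Inter>(range H) \<subseteq> B"
    by metis
  have "residual (A \<inter> B)"
    using G H by (intro compact_metric_residualI[OF cpt, of "range G \<union> range H"]) auto
  then obtain D where "dense D" "D \<subseteq> A \<inter> B" unfolding residual_def by blast
  then have "dense (A \<inter> B)" by (rule dense_superset)
  then show ?thesis unfolding dense_def by auto
qed

section \<open>Empirical measures and their limits\<close>

lemma frequently_imp_subseq:
  fixes P :: "nat \<Rightarrow> bool"
  assumes "\<exists>\<^sub>F n in sequentially. P n"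
  shows "\<exists>r :: nat \<Rightarrow> nat. strict_mono r \<and> (\<forall>k. P (r k))"
proof -
  have "infinite {n. P n}"
    using assms by (simp add: cofinite_eq_sequentially[symmetric] frequently_cofinite)
  from infinite_enumerate[OF this] show ?thesis by simp
qed

lemma frequently_sequentially_subseq:
  fixes r :: "nat \<Rightarrow> nat"
  assumes "strict_mono r" "\<forall>\<^sub>F k in sequentially. P (r k)"
  shows "\<exists>\<^sub>F n in sequentially. P n"
  unfolding frequently_sequentially
proof
  fix N
  obtain K where "\<And>k. k \<ge> K \<Longrightarrow> P (r k)" using assms(2) by (auto simp: eventually_sequentially)
  then show "\<exists>n\<ge>N. P n"
    using seq_suble[OF assms(1), of "max N K"] by (intro exI[of _ "r (max N K)"]) auto
qed

lemma measurable_orbit_segment: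
  "(\<lambda>i. (T ^^ i) x) \<in> measurable (uniform_count_measure {..<n}) borel"
  by (simp add: measurable_def space_uniform_count_measure sets_uniform_count_measure)

lemma integral_empirical_measure:
  fixes f :: "'a::topological_space \<Rightarrow>\<^sub>C real"
  shows "(\<integral>z. f z \<partial>empirical_measure T n x) = (\<Sum>i<n. f ((T ^^ i) x)) / real n"
  unfolding empirical_measure_def
  by (subst integral_distr[OF measurable_orbit_segment])
    (auto simp: integral_uniform_count_measure intro: borel_measurable_continuous_onI)

lemma empirical_measure_in_prob_measures:
  assumes "n > 0"
  shows "empirical_measure T n x \<in> prob_measures"
proof -
  have "prob_space (uniform_count_measure {..<n})"
    using assms by (intro prob_space_uniform_count_measure) auto
  then show ?thesis
    unfolding empirical_measure_def prob_measures_def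
    using measurable_orbit_segment by (auto intro: prob_space.prob_space_distr)
qed

lemma eventually_empirical_measure_prob:
  assumes "strict_mono (r :: nat \<Rightarrow> nat)"
  shows "\<forall>\<^sub>F k in sequentially. empirical_measure T (r k) x \<in> prob_measures"
  using eventually_subseq[OF assms eventually_gt_at_top[of 0]]
  by eventually_elim (rule empirical_measure_in_prob_measures)

lemma continuous_on_funpow:
  fixes T :: "'a::topological_space \<Rightarrow> 'a"
  assumes "continuous_on UNIV T"
  shows "continuous_on UNIV (T ^^ n)"
proof (induction n)
  case (Suc n)
  then show ?case
    unfolding funpow.simps by (intro continuous_on_compose continuous_on_subset[OF assms]) auto
qed (simp add: id_def)

lemma continuous_map_empirical_measure:
  assumes "continuous_on UNIV T" "n > 0"
  shows "continuous_map euclidean weak_star (empirical_measure T n)"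
  unfolding weak_star_def
proof (rule continuous_on_generated_topo)
  have cont: "continuous_on UNIV (\<lambda>x. f ((T ^^ i) x))" for f :: "'a \<Rightarrow>\<^sub>C real" and i
    using continuous_on_compose2[OF continuous_on_apply_bcontfun continuous_on_funpow[OF assms(1)]]
    by blast
  fix W assume "W \<in> {{\<mu> \<in> prob_measures. (\<integral>x. f x \<partial>\<mu>) \<in> U} | (f :: 'a \<Rightarrow>\<^sub>C real) U. open U}"
  then obtain f :: "'a \<Rightarrow>\<^sub>C real" and U
    where W: "W = {\<mu> \<in> prob_measures. (\<integral>x. f x \<partial>\<mu>) \<in> U}" and U: "open U" by blast
  have "empirical_measure T n -` W = (\<lambda>x. (\<Sum>i<n. f ((T ^^ i) x)) / real n) -` U"
    unfolding W using empirical_measure_in_prob_measures[OF assms(2)]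
    by (auto simp: integral_empirical_measure)
  also have "open \<dots>"
    using U by (intro open_vimage continuous_intros cont) (use \<open>n > 0\<close> in auto)
  finally show "openin euclidean (empirical_measure T n -` W \<inter> topspace euclidean)"
    by (simp flip: open_openin)
next
  show "empirical_measure T n ` topspace euclidean
      \<subseteq> \<Union>{{\<mu> \<in> prob_measures. (\<integral>x. f x \<partial>\<mu>) \<in> U} | (f :: 'a \<Rightarrow>\<^sub>C real) U. open U}"
    using topspace_weak_star[where ?'a = 'a] empirical_measure_in_prob_measures[OF assms(2)]
    unfolding weak_star_def topology_generated_by_topspace by blast
qed

locale compact_dynamics =
  fixes T :: "'a::metric_space \<Rightarrow> 'a" and F :: "nat \<Rightarrow> 'a \<Rightarrow>\<^sub>C real"
  assumes compact_UNIV: "compact (UNIV :: 'a set)"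
    and continuous_T: "continuous_on UNIV T"
    and metrizing: "metrizing_family F"
begin

sublocale rho: Metric_space prob_measures "rho F"
  using metrizing by (simp add: metrizing_family_def)

lemma mtopology_rho: "rho.mtopology = weak_star"
  using metrizing by (simp add: metrizing_family_def)

lemma compact_space_weak_star: "compact_space (weak_star :: 'a measure topology)"
  unfolding mtopology_rho[symmetric] rho.compact_space_sequentially
proof (intro allI impI)
  fix \<sigma> :: "nat \<Rightarrow> 'a measure" assume "range \<sigma> \<subseteq> prob_measures"
  then have "\<sigma> n \<in> prob_measures" for n by auto
  then obtain \<mu> r where "\<mu> \<in> prob_measures" "strict_mono r"
      "limitin weak_star (\<sigma> \<circ> r) \<mu> sequentially"
    by (rule prob_measures_seq_compact[OF compact_UNIV])
  then show "\<exists>l r. l \<in> prob_measures \<and> strict_mono r \<and> limitin rho.mtopology (\<sigma> \<circ> r) l sequentially"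
    unfolding mtopology_rho by auto
qed

lemma weak_star_limit_unique:
  assumes "limitin weak_star \<sigma> \<mu> sequentially" "limitin weak_star \<sigma> (\<nu> :: 'a measure) sequentially"
  shows "\<mu> = \<nu>"
  using assms rho.limitin_metric_unique[of \<sigma> \<mu> sequentially \<nu>] by (simp add: mtopology_rho)

text \<open>
  Measures with equal integrals cannot be separated by weak* open sets, while the topology is
  Hausdorff, being metrizable.
\<close>

lemma separating_bcontfun:
  assumes "\<mu> \<in> prob_measures" "\<nu> \<in> prob_measures" "\<mu> \<noteq> \<nu>"
  shows "\<exists>g :: 'a \<Rightarrow>\<^sub>C real. (\<integral>z. g z \<partial>\<mu>) \<noteq> (\<integral>z. g z \<partial>\<nu>)"
proof (rule ccontr)
  assume "\<not> ?thesis"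
  then have "limitin weak_star (\<lambda>_. \<mu>) \<nu> sequentially" "limitin weak_star (\<lambda>_. \<mu>) \<mu> sequentially"
    using assms by (simp_all add: limitin_weak_star_iff topspace_weak_star)
  then have "\<nu> = \<mu>" by (rule weak_star_limit_unique)
  with assms(3) show False by simp
qed

lemma openin_weak_star_ball:
  assumes "openin weak_star W" "(\<mu> :: 'a measure) \<in> W"
  obtains e where "e > 0" "rho.mball \<mu> e \<subseteq> W"
  using assms unfolding mtopology_rho[symmetric] rho.openin_mtopology by blast

text \<open>
  Sequential form of the accumulation points of the empirical measures, available because the
  weak* topology is metrizable by hypothesis.
\<close>

lemma limit_measures_iff_subseq:
  "\<nu> \<in> limit_measures T x \<longleftrightarrow>
    (\<exists>r. strict_mono r \<and> limitin weak_star (\<lambda>k. empirical_measure T (r k) x) \<nu> sequentially)"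
proof
  assume \<nu>: "\<nu> \<in> limit_measures T x"
  then have prob: "\<nu> \<in> prob_measures" by (simp add: limit_measures_def)
  let ?E = "\<lambda>n. empirical_measure T n x"
  have freq: "\<exists>\<^sub>F n in sequentially. ?E n \<in> rho.mball \<nu> (1 / real (Suc k))" for k
  proof -
    have "openin weak_star (rho.mball \<nu> (1 / real (Suc k)))"
      using rho.openin_mball by (simp only: mtopology_rho)
    moreover have "\<nu> \<in> rho.mball \<nu> (1 / real (Suc k))" using prob by simp
    ultimately show ?thesis using \<nu> unfolding limit_measures_def by blast
  qed
  \<comment> \<open>The empirical measures enter each of the shrinking balls infinitely often.\<close>
  have "\<exists>r. \<forall>k. ?E (r k) \<in> rho.mball \<nu> (1 / real (Suc k)) \<and> r k < r (Suc k)"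
  proof (rule dependent_nat_choice)
    show "\<exists>n. ?E n \<in> rho.mball \<nu> (1 / real (Suc 0))"
      using freq[of 0] by (rule frequently_ex)
    show "\<exists>n. ?E n \<in> rho.mball \<nu> (1 / real (Suc (Suc k))) \<and> m < n" for m k
      using freq[of "Suc k"] unfolding frequently_sequentially by (meson Suc_le_eq)
  qed
  then obtain r where r: "\<And>k. ?E (r k) \<in> rho.mball \<nu> (1 / real (Suc k))" "strict_mono r"
    by (auto simp: strict_mono_Suc_iff)
  have "limitin rho.mtopology (\<lambda>k. ?E (r k)) \<nu> sequentially"
    unfolding rho.limitin_metric
  proof (intro conjI prob allI impI)
    fix e :: real assume "e > 0"
    then have "\<forall>\<^sub>F k in sequentially. 1 / real (Suc k) < e"
      using LIMSEQ_inverse_real_of_nat by (auto simp: inverse_eq_divide dest: order_tendstoD(2))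
    then show "\<forall>\<^sub>F k in sequentially. ?E (r k) \<in> prob_measures \<and> rho F (?E (r k)) \<nu> < e"
    proof eventually_elim
      case (elim k)
      then show ?case using r(1)[of k] by (auto simp: rho.commute)
    qed
  qed
  with r(2) show "\<exists>r. strict_mono r \<and> limitin weak_star (\<lambda>k. ?E (r k)) \<nu> sequentially"
    unfolding mtopology_rho by blast
next
  assume "\<exists>r. strict_mono r \<and> limitin weak_star (\<lambda>k. empirical_measure T (r k) x) \<nu> sequentially"
  then obtain r where r: "strict_mono r"
    and lim: "limitin weak_star (\<lambda>k. empirical_measure T (r k) x) \<nu> sequentially" by blast
  show "\<nu> \<in> limit_measures T x"
    unfolding limit_measures_def
  proof (intro CollectI conjI allI impI)
    show "\<nu> \<in> prob_measures" using lim by (simp add: limitin_def topspace_weak_star)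
    fix W assume "openin weak_star W \<and> \<nu> \<in> W"
    then have "\<forall>\<^sub>F k in sequentially. empirical_measure T (r k) x \<in> W"
      using lim unfolding limitin_def by blast
    then show "\<exists>\<^sub>F n in sequentially. empirical_measure T n x \<in> W"
      by (rule frequently_sequentially_subseq[OF r])
  qed
qed

text \<open>
  Compactness: every sequence of times contains a subsequence along which the empirical measures
  converge.
\<close>

lemma subseq_limit_measure:
  assumes r: "strict_mono (r :: nat \<Rightarrow> nat)"
  obtains \<nu> s where "\<nu> \<in> limit_measures T x" "strict_mono s"
    "limitin weak_star (\<lambda>k. empirical_measure T (r (s k)) x) \<nu> sequentially"
proof -
  \<comment> \<open>The first time may be zero, where the empirical measure is not a probability, so it is skipped.\<close>
  have "r (Suc k) > 0" for k
    using strict_mono_less[OF r, of 0 "Suc k"] by simp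
  then have "empirical_measure T (r (Suc k)) x \<in> prob_measures" for k
    by (rule empirical_measure_in_prob_measures)
  then obtain \<nu> s where "\<nu> \<in> prob_measures" and s: "strict_mono s"
    and lim: "limitin weak_star ((\<lambda>k. empirical_measure T (r (Suc k)) x) \<circ> s) \<nu> sequentially"
    by (rule prob_measures_seq_compact[OF compact_UNIV])
  have Ss: "strict_mono (Suc \<circ> s)" using s by (simp add: strict_mono_def)
  show ?thesis
  proof (rule that[OF _ Ss])
    show lim': "limitin weak_star (\<lambda>k. empirical_measure T (r ((Suc \<circ> s) k)) x) \<nu> sequentially"
      using lim by (simp add: o_def)
    show "\<nu> \<in> limit_measures T x"
      unfolding limit_measures_iff_subseq
      using lim' strict_mono_o[OF r Ss] by (auto simp: o_def intro!: exI[of _ "\<lambda>k. r (Suc (s k))"])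
  qed
qed

lemma limit_measures_nonempty: "limit_measures T x \<noteq> {}"
  using subseq_limit_measure[OF strict_mono_id] by blast

lemma limit_measures_prob: "\<mu> \<in> limit_measures T x \<Longrightarrow> \<mu> \<in> prob_measures"
  by (simp add: limit_measures_def)

lemma birkhoff_sum_shift:
  fixes f :: "'a \<Rightarrow>\<^sub>C real"
  shows "(\<integral>z. f z \<partial>empirical_measure T n (T x)) - (\<integral>z. f z \<partial>empirical_measure T n x)
    = (f ((T ^^ n) x) - f x) / real n"
  using sum_lessThan_telescope[of "\<lambda>i. f ((T ^^ i) x)" n]
  by (simp add: integral_empirical_measure funpow_swap1 diff_divide_distrib[symmetric] sum_subtractf)

text \<open>
  Passing to the image point changes only the first and the last term of a Birkhoff sum, which
  is negligible after averaging.
\<close>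

lemma limitin_empirical_measure_shift:
  assumes r: "strict_mono r"
  shows "limitin weak_star (\<lambda>k. empirical_measure T (r k) (T x)) \<nu> sequentially \<longleftrightarrow>
    limitin weak_star (\<lambda>k. empirical_measure T (r k) x) \<nu> sequentially"
proof (cases "\<nu> \<in> prob_measures")
  case True
  have diff: "(\<lambda>k. (\<integral>z. f z \<partial>empirical_measure T (r k) (T x)) - (\<integral>z. f z \<partial>empirical_measure T (r k) x)) \<longlonglongrightarrow> 0"
    for f :: "'a \<Rightarrow>\<^sub>C real"
    unfolding birkhoff_sum_shift
  proof (rule Lim_null_comparison)
    have "\<bar>f ((T ^^ n) x) - f x\<bar> \<le> 2 * norm f" for n
      using abs_bcontfun_le[of f "(T ^^ n) x"] abs_bcontfun_le[of f x] by linarith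
    then show "\<forall>\<^sub>F k in sequentially. norm ((f ((T ^^ r k) x) - f x) / real (r k)) \<le> 2 * norm f / real (r k)"
      by (intro always_eventually allI) (auto simp: divide_right_mono)
    have "(\<lambda>n. 2 * norm f / real n) \<longlonglongrightarrow> 0" by (rule lim_const_over_n)
    from LIMSEQ_subseq_LIMSEQ[OF this r] show "(\<lambda>k. 2 * norm f / real (r k)) \<longlonglongrightarrow> 0" by (simp add: o_def)
  qed
  show ?thesis
    unfolding limitin_weak_star_iff[OF True eventually_empirical_measure_prob[OF r]]
    by (simp only: Lim_transform_eq[OF diff])
qed (auto simp: limitin_def topspace_weak_star)

lemma limit_measures_shift: "limit_measures T (T x) = limit_measures T x"
  by (simp add: set_eq_iff limit_measures_iff_subseq limitin_empirical_measure_shift cong: conj_cong)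

lemma limit_measures_funpow: "limit_measures T ((T ^^ n) x) = limit_measures T x"
  by (induction n) (simp_all add: limit_measures_shift)

text \<open>
  Along a suitable sequence of times the empirical measures of a point and of its image converge
  to the same limit, while the latter also converge to the image of that limit.
\<close>

lemma limit_measures_invariant: "limit_measures T x \<subseteq> invariant_measures T"
proof
  fix \<nu> assume "\<nu> \<in> limit_measures T x"
  then obtain r where r: "strict_mono r"
    and lim: "limitin weak_star (\<lambda>k. empirical_measure T (r k) x) \<nu> sequentially"
    and \<nu>: "\<nu> \<in> prob_measures"
    using limit_measures_iff_subseq limit_measures_prob by blast
  have T[measurable]: "T \<in> borel_measurable \<nu>"
    using continuous_T
    by (simp add: measurable_cong_sets[OF prob_measuresD(2)[OF \<nu>] refl] borel_measurable_continuous_onI)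
  have push: "distr \<nu> borel T \<in> prob_measures"
    using prob_space.prob_space_distr[OF prob_measuresD(1)[OF \<nu>] T] by (simp add: prob_measures_def)
  \<comment> \<open>The empirical measures of the image point are the images of the empirical measures.\<close>
  have "limitin weak_star (\<lambda>k. empirical_measure T (r k) (T x)) (distr \<nu> borel T) sequentially"
    unfolding limitin_weak_star_iff[OF push eventually_empirical_measure_prob[OF r]]
  proof
    fix f :: "'a \<Rightarrow>\<^sub>C real"
    obtain g :: "'a \<Rightarrow>\<^sub>C real" where g: "apply_bcontfun g = (\<lambda>x. f (T x))"
      using continuous_on_compact_bcontfun[OF compact_UNIV, of "\<lambda>x. f (T x)"]
        continuous_on_compose2[OF continuous_on_apply_bcontfun continuous_T] by blast
    have "(\<integral>z. f z \<partial>distr \<nu> borel T) = (\<integral>z. g z \<partial>\<nu>)"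
      unfolding g by (rule integral_distr[OF T]) (simp add: borel_measurable_continuous_onI)
    moreover have "(\<integral>z. f z \<partial>empirical_measure T n (T x)) = (\<integral>z. g z \<partial>empirical_measure T n x)" for n
      unfolding integral_empirical_measure by (simp add: g funpow_swap1)
    moreover have "(\<lambda>k. \<integral>z. g z \<partial>empirical_measure T (r k) x) \<longlonglongrightarrow> (\<integral>z. g z \<partial>\<nu>)"
      using lim by (simp add: limitin_weak_star_iff[OF \<nu> eventually_empirical_measure_prob[OF r]])
    ultimately show "(\<lambda>k. \<integral>z. f z \<partial>empirical_measure T (r k) (T x)) \<longlonglongrightarrow> (\<integral>z. f z \<partial>distr \<nu> borel T)"
      by simp
  qed
  then have "distr \<nu> borel T = \<nu>"
    using lim limitin_empirical_measure_shift[OF r] weak_star_limit_unique by blast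
  with \<nu> show "\<nu> \<in> invariant_measures T" by (simp add: invariant_measures_def)
qed

section \<open>Basins\<close>

text \<open>
  The distance from a measure to the compact set of limit measures is the lower limit of its
  distances to the empirical measures. This replaces limit measures by empirical measures, which
  depend continuously on the point, and so makes the descriptive complexity of a basin visible.
\<close>

lemma basin_iff_frequently:
  assumes \<mu>: "\<mu> \<in> prob_measures"
  shows "x \<in> basin F T \<mu> \<epsilon> \<longleftrightarrow>
    (\<forall>\<delta>>\<epsilon>. \<exists>\<^sub>F n in sequentially. empirical_measure T n x \<in> rho.mball \<mu> \<delta>)"
proof -
  let ?E = "\<lambda>n. empirical_measure T n x" and ?V = "limit_measures T x"
  have bdd: "bdd_below (rho F \<mu> ` ?V)"
    by (intro bdd_belowI[of _ 0]) auto
  show ?thesis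
  proof (intro iffI allI impI)
    fix \<delta> assume "x \<in> basin F T \<mu> \<epsilon>" "\<delta> > \<epsilon>"
    then have "(INF \<nu>\<in>?V. rho F \<mu> \<nu>) < \<delta>" by (simp add: basin_def)
    then obtain \<nu> where \<nu>: "\<nu> \<in> ?V" "rho F \<mu> \<nu> < \<delta>"
      using cINF_less_iff[OF limit_measures_nonempty bdd] by blast
    then have "\<nu> \<in> rho.mball \<mu> \<delta>" using \<mu> by (simp add: limit_measures_prob)
    moreover have "openin weak_star (rho.mball \<mu> \<delta>)"
      using rho.openin_mball by (simp only: mtopology_rho)
    ultimately show "\<exists>\<^sub>F n in sequentially. ?E n \<in> rho.mball \<mu> \<delta>"
      using \<nu>(1) unfolding limit_measures_def by blast
  next
    assume freq: "\<forall>\<delta>>\<epsilon>. \<exists>\<^sub>F n in sequentially. ?E n \<in> rho.mball \<mu> \<delta>"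
    have "(INF \<nu>\<in>?V. rho F \<mu> \<nu>) \<le> \<delta>" if "\<delta> > \<epsilon>" for \<delta>
    proof -
      obtain r where r: "strict_mono (r :: nat \<Rightarrow> nat)" "\<And>k. ?E (r k) \<in> rho.mball \<mu> \<delta>"
        using frequently_imp_subseq[OF freq[rule_format, OF \<open>\<delta> > \<epsilon>\<close>]] by blast
      obtain \<nu> s where \<nu>: "\<nu> \<in> ?V" and "strict_mono s"
        and lim: "limitin weak_star (\<lambda>k. ?E (r (s k))) \<nu> sequentially"
        by (rule subseq_limit_measure[OF r(1), of x])
      have "rho F \<mu> \<nu> \<le> \<delta> + e" if "e > 0" for e
      proof -
        have "\<forall>\<^sub>F k in sequentially. ?E (r (s k)) \<in> prob_measures \<and> rho F (?E (r (s k))) \<nu> < e"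
          using lim \<open>e > 0\<close> unfolding mtopology_rho[symmetric] rho.limitin_metric by blast
        from eventually_happens'[OF sequentially_bot this]
        obtain k where k: "?E (r (s k)) \<in> prob_measures" "rho F (?E (r (s k))) \<nu> < e"
          by auto
        have "rho F \<mu> \<nu> \<le> rho F \<mu> (?E (r (s k))) + rho F (?E (r (s k))) \<nu>"
          using \<mu> k(1) limit_measures_prob[OF \<nu>] by (intro rho.triangle)
        also have "rho F \<mu> (?E (r (s k))) < \<delta>" using r(2)[of "s k"] by simp
        finally show ?thesis using k(2) by simp
      qed
      then have "rho F \<mu> \<nu> \<le> \<delta>" by (rule field_le_epsilon)
      then show ?thesis by (intro cINF_lower2[OF bdd \<nu>])
    qed
    then show "x \<in> basin F T \<mu> \<epsilon>" unfolding basin_def by (simp add: dense_ge)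
  qed
qed

lemma open_empirical_measure_vimage:
  assumes "openin weak_star W" "n > 0"
  shows "open {x. empirical_measure T n x \<in> W}"
  using openin_continuous_map_preimage[OF continuous_map_empirical_measure[OF continuous_T assms(2)] assms(1)]
  by (simp flip: open_openin)

text \<open>
  The condition on the empirical measures exhibits the basin as a countable intersection of open
  sets.
\<close>

lemma basin_borel:
  assumes \<mu>: "\<mu> \<in> prob_measures"
  shows "basin F T \<mu> \<epsilon> \<in> sets borel"
proof -
  let ?O = "\<lambda>k n. {x. empirical_measure T n x \<in> rho.mball \<mu> (\<epsilon> + 1 / real (Suc k))}"
  \<comment> \<open>The index starts at one because the empirical measure of length zero is no probability.\<close>
  have "basin F T \<mu> \<epsilon> = (\<Inter>k N. \<Union>n\<in>{max 1 N..}. ?O k n)"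
  proof (intro set_eqI iffI)
    fix x assume x: "x \<in> basin F T \<mu> \<epsilon>"
    show "x \<in> (\<Inter>k N. \<Union>n\<in>{max 1 N..}. ?O k n)"
    proof (intro INT_I)
      fix k N :: nat
      have "\<exists>\<^sub>F n in sequentially. empirical_measure T n x \<in> rho.mball \<mu> (\<epsilon> + 1 / real (Suc k))"
        using x[unfolded basin_iff_frequently[OF \<mu>], rule_format, of "\<epsilon> + 1 / real (Suc k)"] by simp
      then show "x \<in> (\<Union>n\<in>{max 1 N..}. ?O k n)"
        unfolding frequently_sequentially by (auto dest: spec[of _ "max 1 N"])
    qed
  next
    fix x assume x: "x \<in> (\<Inter>k N. \<Union>n\<in>{max 1 N..}. ?O k n)"
    show "x \<in> basin F T \<mu> \<epsilon>"
      unfolding basin_iff_frequently[OF \<mu>] frequently_sequentially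
    proof (intro allI impI)
      fix \<delta> N assume "\<delta> > \<epsilon>"
      then obtain k where "1 / real (Suc k) < \<delta> - \<epsilon>"
        using reals_Archimedean[of "\<delta> - \<epsilon>"] by (auto simp: inverse_eq_divide)
      then have sub: "rho.mball \<mu> (\<epsilon> + 1 / real (Suc k)) \<subseteq> rho.mball \<mu> \<delta>"
        by (intro rho.mball_subset_concentric) simp
      have "x \<in> (\<Union>n\<in>{max 1 N..}. ?O k n)" using x by blast
      then obtain n where "n \<ge> N" "empirical_measure T n x \<in> rho.mball \<mu> (\<epsilon> + 1 / real (Suc k))"
        by auto
      with sub show "\<exists>n\<ge>N. empirical_measure T n x \<in> rho.mball \<mu> \<delta>" by blast
    qed
  qed
  moreover have "?O k n \<in> sets borel" if "n > 0" for k n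
    using open_empirical_measure_vimage[OF _ that, of "rho.mball \<mu> _"] rho.openin_mball
    unfolding mtopology_rho by (intro borel_open) blast
  ultimately show ?thesis
    by (auto intro!: sets.countable_INT' sets.countable_UN')
qed

lemma in_basin_if_near_limit_measure:
  assumes "\<nu> \<in> limit_measures T x" "rho F \<mu> \<nu> \<le> \<epsilon>"
  shows "x \<in> basin F T \<mu> \<epsilon>"
  unfolding basin_def
  using assms by (auto intro!: cINF_lower2[of _ _ \<nu>] bdd_belowI[of _ 0])

lemma basin_funpow: "(T ^^ n) x \<in> basin F T \<mu> \<epsilon> \<longleftrightarrow> x \<in> basin F T \<mu> \<epsilon>"
  by (simp add: basin_def limit_measures_funpow)

section \<open>Birkhoff averages\<close>

text \<open>
  A limit measure integrates the function to an accumulation point of the Birkhoff averages;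
  conversely the lower limit of the averages is attained along a subsequence, on which
  compactness yields a limit measure.
\<close>

lemma lower_average_eq_INF:
  "lower_average T f x = (INF \<mu>\<in>limit_measures T x. ereal (\<integral>z. f z \<partial>\<mu>))"
proof -
  let ?a = "\<lambda>n. ereal (\<integral>z. f z \<partial>empirical_measure T n x)"
  have low: "lower_average T f x = liminf ?a"
    by (simp add: lower_average_def integral_empirical_measure)
  show ?thesis
  proof (rule antisym)
    show "lower_average T f x \<le> (INF \<mu>\<in>limit_measures T x. ereal (\<integral>z. f z \<partial>\<mu>))"
    proof (rule INF_greatest)
      fix \<mu> assume \<mu>: "\<mu> \<in> limit_measures T x"
      then obtain r where r: "strict_mono r"
        and lim: "limitin weak_star (\<lambda>k. empirical_measure T (r k) x) \<mu> sequentially"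
        using limit_measures_iff_subseq by blast
      then have "(?a \<circ> r) \<longlonglongrightarrow> ereal (\<integral>z. f z \<partial>\<mu>)"
        by (simp add: limitin_weak_star_iff[OF limit_measures_prob[OF \<mu>] eventually_empirical_measure_prob[OF r]] o_def)
      then have "liminf (?a \<circ> r) = ereal (\<integral>z. f z \<partial>\<mu>)"
        by (rule lim_imp_Liminf[OF sequentially_bot])
      then show "lower_average T f x \<le> ereal (\<integral>z. f z \<partial>\<mu>)"
        unfolding low using liminf_subseq_mono[OF r, of ?a] by simp
    qed
    obtain r where r: "strict_mono r" "(?a \<circ> r) \<longlonglongrightarrow> liminf ?a"
      using liminf_subseq_lim by blast
    obtain \<nu> s where \<nu>: "\<nu> \<in> limit_measures T x" and s: "strict_mono s"
      and lim: "limitin weak_star (\<lambda>k. empirical_measure T (r (s k)) x) \<nu> sequentially"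
      by (rule subseq_limit_measure[OF r(1), of x])
    have "((?a \<circ> r) \<circ> s) \<longlonglongrightarrow> ereal (\<integral>z. f z \<partial>\<nu>)"
      using lim limitin_weak_star_iff[OF limit_measures_prob[OF \<nu>] eventually_empirical_measure_prob[OF strict_mono_o[OF r(1) s]]]
      by (simp add: o_def)
    then have lim_eq: "liminf ?a = ereal (\<integral>z. f z \<partial>\<nu>)"
      using LIMSEQ_subseq_LIMSEQ[OF r(2) s] LIMSEQ_unique by blast
    show "(INF \<mu>\<in>limit_measures T x. ereal (\<integral>z. f z \<partial>\<mu>)) \<le> lower_average T f x"
      unfolding low lim_eq using \<nu> by (rule INF_lower)
  qed
qed

lemma upper_average_eq_SUP:
  "upper_average T f x = (SUP \<mu>\<in>limit_measures T x. ereal (\<integral>z. f z \<partial>\<mu>))"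
proof -
  have "lower_average T (- f) x = liminf (\<lambda>n. - ereal ((\<Sum>i<n. f ((T ^^ i) x)) / real n))"
    by (simp add: lower_average_def sum_negf)
  also have "\<dots> = - upper_average T f x"
    unfolding upper_average_def by (rule ereal_Liminf_uminus)
  finally have "upper_average T f x = - lower_average T (- f) x" by simp
  also have "\<dots> = - (INF \<mu>\<in>limit_measures T x. - ereal (\<integral>z. f z \<partial>\<mu>))"
    unfolding lower_average_eq_INF by simp
  also have "\<dots> = (SUP \<mu>\<in>limit_measures T x. ereal (\<integral>z. f z \<partial>\<mu>))"
    by (simp only: ereal_INF_uminus_eq ereal_uminus_uminus)
  finally show ?thesis .
qed

lemma irregular_iff_integrals_differ:
  assumes "limit_measures T x = M"
  shows "x \<in> irregular_set T f \<longleftrightarrow> (\<exists>\<mu>\<in>M. \<exists>\<nu>\<in>M. (\<integral>z. f z \<partial>\<mu>) \<noteq> (\<integral>z. f z \<partial>\<nu>))"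
proof -
  let ?I = "\<lambda>\<mu>. ereal (\<integral>z. f z \<partial>\<mu>)"
  have "x \<in> irregular_set T f \<longleftrightarrow> (INF \<mu>\<in>M. ?I \<mu>) \<noteq> (SUP \<mu>\<in>M. ?I \<mu>)"
    by (simp add: irregular_set_def lower_average_eq_INF upper_average_eq_SUP assms)
  also have "\<dots> \<longleftrightarrow> (\<exists>\<mu>\<in>M. \<exists>\<nu>\<in>M. (\<integral>z. f z \<partial>\<mu>) \<noteq> (\<integral>z. f z \<partial>\<nu>))"
  proof (intro iffI; rule ccontr)
    assume ne: "(INF \<mu>\<in>M. ?I \<mu>) \<noteq> (SUP \<mu>\<in>M. ?I \<mu>)"
      and eq: "\<not> (\<exists>\<mu>\<in>M. \<exists>\<nu>\<in>M. (\<integral>z. f z \<partial>\<mu>) \<noteq> (\<integral>z. f z \<partial>\<nu>))"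
    obtain \<mu> where "\<mu> \<in> M" using limit_measures_nonempty[of x] assms by blast
    have "?I ` M = (\<lambda>_. ?I \<mu>) ` M"
      by (rule image_cong) (use eq \<open>\<mu> \<in> M\<close> in blast)+
    with ne \<open>\<mu> \<in> M\<close> show False by (simp only: image_constant[OF \<open>\<mu> \<in> M\<close>] Inf_insert Sup_insert) simp
  next
    assume "\<exists>\<mu>\<in>M. \<exists>\<nu>\<in>M. (\<integral>z. f z \<partial>\<mu>) \<noteq> (\<integral>z. f z \<partial>\<nu>)"
      and eq: "\<not> (INF \<mu>\<in>M. ?I \<mu>) \<noteq> (SUP \<mu>\<in>M. ?I \<mu>)"
    then obtain \<mu> \<nu> where M: "\<mu> \<in> M" "\<nu> \<in> M" and ne: "?I \<mu> \<noteq> ?I \<nu>" by auto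
    have "?I \<kappa> = (INF \<mu>\<in>M. ?I \<mu>)" if "\<kappa> \<in> M" for \<kappa>
      using INF_lower[of \<kappa> M ?I] SUP_upper[of \<kappa> M ?I] that eq by auto
    from this[OF M(1)] this[OF M(2)] ne show False by simp
  qed
  finally show ?thesis .
qed

section \<open>Transitive points\<close>

lemma Trans_iff: "x \<in> Trans T \<longleftrightarrow> (\<forall>V. open V \<longrightarrow> V \<noteq> {} \<longrightarrow> (\<exists>n. (T ^^ n) x \<in> V))"
proof -
  have "range (\<lambda>n. (T ^^ n) x) \<inter> V \<noteq> {} \<longleftrightarrow> (\<exists>n. (T ^^ n) x \<in> V)" for V
    by auto
  then show ?thesis by (simp add: Trans_def dense_iff_meets_open)
qed

lemma open_funpow_vimage: "open V \<Longrightarrow> open ((T ^^ n) -` V)"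
  by (rule open_vimage[OF _ continuous_on_funpow[OF continuous_T]])

end

locale transitive_dynamics = compact_dynamics +
  assumes transitive: "transitive_system T"
begin

lemma hitting_set_dense:
  assumes "open V" "V \<noteq> {}"
  shows "dense (\<Union>n. (T ^^ n) -` V)"
  unfolding dense_iff_meets_open
proof (intro allI impI)
  fix U :: "'a set" assume "open U" "U \<noteq> {}"
  then obtain n where "U \<inter> (T ^^ n) -` V \<noteq> {}"
    using transitive assms unfolding transitive_system_def by metis
  then show "(\<Union>n. (T ^^ n) -` V) \<inter> U \<noteq> {}" by blast
qed

text \<open>
  Removing the first point of a dense orbit could destroy density only if that point were
  isolated. In a transitive system an isolated point is periodic, so that it is visited again.
\<close>

lemma Trans_shift: "T x \<in> Trans T \<longleftrightarrow> x \<in> Trans T"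
proof
  assume "T x \<in> Trans T"
  then show "x \<in> Trans T"
    unfolding Trans_iff by (metis comp_apply funpow_Suc_right)
next
  assume x: "x \<in> Trans T"
  show "T x \<in> Trans T"
    unfolding Trans_iff
  proof (intro allI impI, rule ccontr)
    fix V assume V: "open V" "V \<noteq> {}" and "\<nexists>n. (T ^^ n) (T x) \<in> V"
    then have miss: "(T ^^ Suc n) x \<notin> V" for n by (simp add: funpow_swap1)
    have only: "n = 0" if "(T ^^ n) x \<in> V" for n using miss that by (cases n) auto
    \<comment> \<open>The orbit meets the open set only at time zero, so the point is isolated.\<close>
    have "V = {x}"
    proof (rule ccontr)
      obtain n where "(T ^^ n) x \<in> V" using x V unfolding Trans_iff by blast
      then have "x \<in> V" using only[of n] by auto
      moreover assume "V \<noteq> {x}"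
      ultimately have "open (V - {x})" "V - {x} \<noteq> {}" using V by (auto intro: open_Diff)
      then obtain n where n: "(T ^^ n) x \<in> V - {x}" using x unfolding Trans_iff by blast
      then show False using only[of n] by auto
    qed
    \<comment> \<open>Transitivity leads from the complement of the isolated point back to it, and a nonempty open
      set of points does so, hence the orbit itself returns at a positive time.\<close>
    define U where "U = - {x}"
    have "U \<noteq> {}" using miss[of 0] \<open>V = {x}\<close> by (auto simp: U_def)
    have "open U" unfolding U_def by (rule open_Compl) simp
    then obtain n where "U \<inter> (T ^^ n) -` V \<noteq> {}"
      using transitive V \<open>U \<noteq> {}\<close> unfolding transitive_system_def by metis
    moreover have "open (U \<inter> (T ^^ n) -` V)"
      using \<open>open U\<close> open_funpow_vimage[OF V(1)] by (rule open_Int)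
    ultimately obtain k where k: "(T ^^ k) x \<in> U" "(T ^^ n) ((T ^^ k) x) \<in> V"
      using x unfolding Trans_iff by blast
    then have "(T ^^ (n + k)) x \<in> V" by (simp add: funpow_add)
    then have "n + k = 0" by (rule only)
    with k(1) show False by (simp add: U_def)
  qed
qed

section \<open>Generic points\<close>

text \<open>
  \<^const>\<open>M_dense\<close> is the invariant part of this set. Keeping the two conditions
  apart allows membership to be proved from the basins alone.
\<close>

definition dense_basin_measures :: "'a measure set" where
  "dense_basin_measures = {\<mu> \<in> prob_measures. \<forall>\<epsilon>>0. dense (basin F T \<mu> \<epsilon>)}"

text \<open>
  A limit measure of a dense orbit is a limit measure of every point of that orbit.
\<close>

lemma M_Trans_dense_basin: "M_Trans T \<subseteq> dense_basin_measures"
proof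
  fix \<mu> assume "\<mu> \<in> M_Trans T"
  then obtain y where y: "y \<in> Trans T" "\<mu> \<in> limit_measures T y" by (auto simp: M_Trans_def)
  have "dense (basin F T \<mu> \<epsilon>)" if "\<epsilon> > 0" for \<epsilon>
    unfolding dense_iff_meets_open
  proof (intro allI impI)
    fix U :: "'a set" assume "open U" "U \<noteq> {}"
    then obtain n where "(T ^^ n) y \<in> U" using y(1) unfolding Trans_iff by blast
    moreover have "(T ^^ n) y \<in> basin F T \<mu> \<epsilon>"
      using in_basin_if_near_limit_measure[OF y(2), of \<mu> \<epsilon>] limit_measures_prob[OF y(2)] \<open>\<epsilon> > 0\<close>
      by (simp add: basin_funpow)
    ultimately show "basin F T \<mu> \<epsilon> \<inter> U \<noteq> {}" by blast
  qed
  then show "\<mu> \<in> dense_basin_measures"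
    using limit_measures_prob[OF y(2)] by (simp add: dense_basin_measures_def)
qed

text \<open>
  If a weak* open set contains a measure whose basins are dense, then the points whose empirical
  measures visit that set after time \<open>N\<close> form an open set containing a basin, hence
  an open dense set. Letting the open set range over a countable base and \<open>N\<close> over
  all times, a generic point visits every neighbourhood of each such measure infinitely often.
  Transitivity makes the orbit of a generic point dense in the same way.
\<close>

lemma residual_all_dense_basin_measures:
  "residual {x \<in> Trans T. dense_basin_measures \<subseteq> limit_measures T x}"
proof -
  obtain \<B> :: "'a set set" where \<B>: "countable \<B>" "\<And>V. V \<in> \<B> \<Longrightarrow> open V"
    "\<And>U x. open U \<Longrightarrow> x \<in> U \<Longrightarrow> \<exists>V\<in>\<B>. x \<in> V \<and> V \<subseteq> U"
    by (rule compact_metric_countable_base[OF compact_UNIV]) blast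
  have "second_countable (weak_star :: 'a measure topology)"
    using rho.compact_space_imp_second_countable compact_space_weak_star by (simp add: mtopology_rho)
  from this[unfolded second_countable_def] obtain \<C> :: "'a measure set set"
    where "countable \<C> \<and> (\<forall>W\<in>\<C>. openin weak_star W) \<and>
      (\<forall>W \<mu>. openin weak_star W \<and> \<mu> \<in> W \<longrightarrow> (\<exists>W'\<in>\<C>. \<mu> \<in> W' \<and> W' \<subseteq> W))" ..
  then have \<C>: "countable \<C>" "\<And>W. W \<in> \<C> \<Longrightarrow> openin weak_star W"
    "\<And>W \<mu>. openin weak_star W \<Longrightarrow> \<mu> \<in> W \<Longrightarrow> \<exists>W'\<in>\<C>. \<mu> \<in> W' \<and> W' \<subseteq> W"
    by simp_all
  let ?hit = "\<lambda>V. \<Union>n. (T ^^ n) -` V"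
  let ?visit = "\<lambda>W N. \<Union>n\<in>{max 1 N..}. {x. empirical_measure T n x \<in> W}"
  define \<C>' where "\<C>' = {W \<in> \<C>. W \<inter> dense_basin_measures \<noteq> {}}"
  define \<G> where "\<G> = ?hit ` (\<B> - {{}}) \<union> (\<Union>N. (\<lambda>W. ?visit W N) ` \<C>')"
  have visit_dense: "dense (?visit W N)" if W: "W \<in> \<C>'" for W N
  proof -
    obtain \<mu> where \<mu>: "\<mu> \<in> W" "\<mu> \<in> prob_measures" "\<And>\<epsilon>. \<epsilon> > 0 \<Longrightarrow> dense (basin F T \<mu> \<epsilon>)"
      using W by (auto simp: \<C>'_def dense_basin_measures_def)
    obtain e where e: "e > 0" "rho.mball \<mu> e \<subseteq> W"
      using openin_weak_star_ball[OF _ \<mu>(1)] \<C>(2) W unfolding \<C>'_def by blast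
    have "basin F T \<mu> (e / 2) \<subseteq> ?visit W N"
    proof
      fix x assume x: "x \<in> basin F T \<mu> (e / 2)"
      have "\<exists>\<^sub>F n in sequentially. empirical_measure T n x \<in> rho.mball \<mu> e"
        by (rule x[unfolded basin_iff_frequently[OF \<mu>(2)], rule_format]) (use e(1) in auto)
      then obtain n where "n \<ge> max 1 N" "empirical_measure T n x \<in> rho.mball \<mu> e"
        unfolding frequently_sequentially by blast
      with e(2) show "x \<in> ?visit W N" by blast
    qed
    moreover have "dense (basin F T \<mu> (e / 2))" using \<mu>(3) e(1) by simp
    ultimately show ?thesis using dense_superset by blast
  qed
  show ?thesis
  proof (rule compact_metric_residualI[OF compact_UNIV, of \<G>])
    show "countable \<G>"
      unfolding \<G>_def \<C>'_def using \<B>(1) \<C>(1) by auto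
    fix G assume "G \<in> \<G>"
    then consider V where "V \<in> \<B>" "V \<noteq> {}" "G = ?hit V" | W N where "W \<in> \<C>'" "G = ?visit W N"
      unfolding \<G>_def by blast
    then show "open G"
    proof cases
      case 1
      then show ?thesis using open_funpow_vimage \<B>(2) by blast
    next
      case 2
      then have W: "openin weak_star W" using \<C>(2) by (simp add: \<C>'_def)
      show ?thesis unfolding 2(2) by (intro open_UN ballI open_empirical_measure_vimage[OF W]) auto
    qed
    show "dense G"
      using \<open>G \<in> \<G>\<close> hitting_set_dense \<B>(2) visit_dense unfolding \<G>_def by blast
  next
    show "\<Inter>\<G> \<subseteq> {x \<in> Trans T. dense_basin_measures \<subseteq> limit_measures T x}"
    proof (intro subsetI CollectI conjI)
      fix x assume x: "x \<in> \<Inter>\<G>"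
      show "x \<in> Trans T"
        unfolding Trans_iff
      proof (intro allI impI)
        fix U :: "'a set" assume "open U" "U \<noteq> {}"
        then obtain V where "V \<in> \<B>" "V \<noteq> {}" "V \<subseteq> U" using \<B>(3) by blast
        then have "?hit V \<in> \<G>" by (auto simp: \<G>_def)
        then have "x \<in> ?hit V" using x by blast
        with \<open>V \<subseteq> U\<close> show "\<exists>n. (T ^^ n) x \<in> U" by blast
      qed
      fix \<mu> assume \<mu>: "\<mu> \<in> dense_basin_measures"
      show "\<mu> \<in> limit_measures T x"
        unfolding limit_measures_def frequently_sequentially
      proof (intro CollectI conjI allI impI)
        show "\<mu> \<in> prob_measures" using \<mu> by (simp add: dense_basin_measures_def)
        fix W N assume "openin weak_star W \<and> \<mu> \<in> W"
        then obtain W' where W': "W' \<in> \<C>" "\<mu> \<in> W'" "W' \<subseteq> W" using \<C>(3) by blast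
        then have "W' \<in> \<C>'" using \<mu> by (auto simp: \<C>'_def)
        then have "?visit W' N \<in> \<G>" unfolding \<G>_def by blast
        then have "x \<in> ?visit W' N" using x by blast
        then obtain n where "n \<ge> max 1 N" "empirical_measure T n x \<in> W'" by blast
        with W'(3) show "\<exists>n\<ge>N. empirical_measure T n x \<in> W" by auto
      qed
    qed
  qed
qed

lemma dense_basin_measures_subset_M_Trans: "dense_basin_measures \<subseteq> M_Trans T"
proof -
  obtain x where "x \<in> Trans T" "dense_basin_measures \<subseteq> limit_measures T x"
    using residual_Int_nonempty[OF compact_UNIV residual_all_dense_basin_measures
        residual_all_dense_basin_measures] by blast
  then show ?thesis by (auto simp: M_Trans_def)
qed

lemma dense_basin_measures_eq: "dense_basin_measures = M_Trans T"
  using dense_basin_measures_subset_M_Trans M_Trans_dense_basin by blast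

lemma M_dense_eq: "M_dense F T = M_Trans T"
proof -
  have "M_dense F T = invariant_measures T \<inter> dense_basin_measures"
    by (auto simp: M_dense_def dense_basin_measures_def invariant_measures_def)
  moreover have "M_Trans T \<subseteq> invariant_measures T"
    using limit_measures_invariant by (auto simp: M_Trans_def)
  ultimately show ?thesis by (auto simp: dense_basin_measures_eq)
qed

definition generic_points :: "'a set" where
  "generic_points = {x \<in> Trans T. limit_measures T x = M_Trans T}"

lemma residual_generic_points: "residual generic_points"
proof -
  have "{x \<in> Trans T. dense_basin_measures \<subseteq> limit_measures T x} = generic_points"
    by (auto simp: generic_points_def dense_basin_measures_eq) (auto simp: M_Trans_def)
  then show ?thesis using residual_all_dense_basin_measures by simp
qed

lemma invariant_generic_points: "invariant T generic_points"
  by (auto simp: invariant_def generic_points_def Trans_shift limit_measures_shift)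

lemma residual_meets_generic: "residual S \<Longrightarrow> S \<inter> generic_points \<noteq> {}"
  using residual_Int_nonempty[OF compact_UNIV _ residual_generic_points] .

lemma generic_point_exists: "generic_points \<noteq> {}"
  using residual_meets_generic[OF residual_generic_points] by simp

lemma M_Trans_prob: "M_Trans T \<subseteq> prob_measures"
  by (auto simp: M_Trans_def limit_measures_prob)

lemma M_Trans_nonempty: "M_Trans T \<noteq> {}"
  using generic_point_exists limit_measures_nonempty by (auto simp: generic_points_def)

lemma INF_lower_average_Trans:
  "(INF y\<in>Trans T. lower_average T f y) = (INF \<mu>\<in>M_Trans T. ereal (\<integral>z. f z \<partial>\<mu>))"
proof -
  let ?I = "\<lambda>\<mu>. ereal (\<integral>z. f z \<partial>\<mu>)"
  have "(INF \<mu>\<in>M_Trans T. ?I \<mu>) = (INF y\<in>Trans T. INF \<mu>\<in>limit_measures T y. ?I \<mu>)"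
    unfolding M_Trans_def
  proof (rule antisym)
    show "(INF \<mu>\<in>(\<Union>y\<in>Trans T. limit_measures T y). ?I \<mu>) \<le> (INF y\<in>Trans T. INF \<mu>\<in>limit_measures T y. ?I \<mu>)"
      by (intro INF_greatest INF_lower) blast
    show "(INF y\<in>Trans T. INF \<mu>\<in>limit_measures T y. ?I \<mu>) \<le> (INF \<mu>\<in>(\<Union>y\<in>Trans T. limit_measures T y). ?I \<mu>)"
      by (rule INF_greatest) (blast intro: INF_lower2 INF_lower)
  qed
  then show ?thesis by (simp only: lower_average_eq_INF)
qed

lemma SUP_upper_average_Trans:
  "(SUP y\<in>Trans T. upper_average T f y) = (SUP \<mu>\<in>M_Trans T. ereal (\<integral>z. f z \<partial>\<mu>))"
  by (simp add: upper_average_eq_SUP M_Trans_def SUP_UNION)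

section \<open>Physical-like measures\<close>

text \<open>
  It does not suffice to find a physical-like measure; it must be a limit measure of a dense
  orbit. So the mass is localized at a transitive point \<open>y\<close>: compactness gives a
  measure all of whose basins have positive mass in every neighbourhood of \<open>y\<close>.
  Each basin then accumulates at \<open>y\<close>; since the orbit of \<open>y\<close> enters
  every open set and basins are invariant, they are all dense.
\<close>

lemma physical_like_exists:
  fixes m :: "'a measure"
  assumes sets_m: "sets m = sets borel"
    and pos: "\<And>W. open W \<Longrightarrow> W \<noteq> {} \<Longrightarrow> emeasure m W > 0"
  shows "M_Trans T \<inter> physical_like F T m \<noteq> {}"
proof -
  obtain y where y: "y \<in> Trans T" using generic_point_exists by (auto simp: generic_points_def)
  let ?B = "\<lambda>k :: nat. ball y (1 / real (Suc k))"
  have meas: "?B k \<inter> basin F T \<mu> \<epsilon> \<in> sets m" if "\<mu> \<in> prob_measures" for k \<mu> \<epsilon>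
    unfolding sets_m using basin_borel[OF that] by auto
  have "\<exists>\<mu>\<in>prob_measures. \<forall>k. \<forall>\<epsilon>>0. emeasure m (?B k \<inter> basin F T \<mu> \<epsilon>) > 0"
  proof (rule ccontr)
    \<comment> \<open>Otherwise finitely many balls of bad measures cover all measures, and since every point has
      a limit measure, a small ball about the transitive point is a finite union of null sets.\<close>
    assume "\<not> ?thesis"
    then have "\<forall>\<mu>\<in>prob_measures. \<exists>k \<epsilon>. \<epsilon> > 0 \<and> emeasure m (?B k \<inter> basin F T \<mu> \<epsilon>) = 0"
      by (simp add: zero_less_iff_neq_zero)
    then obtain k \<epsilon> where null: "\<And>\<mu>. \<mu> \<in> prob_measures \<Longrightarrow> \<epsilon> \<mu> > 0"
      "\<And>\<mu>. \<mu> \<in> prob_measures \<Longrightarrow> emeasure m (?B (k \<mu>) \<inter> basin F T \<mu> (\<epsilon> \<mu>)) = 0"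
      by metis
    have "compactin rho.mtopology prob_measures"
      using compact_space_weak_star by (simp add: mtopology_rho compact_space_def topspace_weak_star)
    then have "\<exists>\<F>. finite \<F> \<and> \<F> \<subseteq> (\<lambda>\<mu>. rho.mball \<mu> (\<epsilon> \<mu>)) ` prob_measures \<and> prob_measures \<subseteq> \<Union>\<F>"
    proof (rule compactinD)
      show "prob_measures \<subseteq> \<Union>((\<lambda>\<mu>. rho.mball \<mu> (\<epsilon> \<mu>)) ` prob_measures)"
        using null(1) rho.centre_in_mball_iff by blast
    qed auto
    then obtain \<F> where \<F>: "finite \<F>" "\<F> \<subseteq> (\<lambda>\<mu>. rho.mball \<mu> (\<epsilon> \<mu>)) ` prob_measures" "prob_measures \<subseteq> \<Union>\<F>"
      by (elim exE conjE)
    obtain C where C: "C \<subseteq> prob_measures" "finite C" "\<F> = (\<lambda>\<mu>. rho.mball \<mu> (\<epsilon> \<mu>)) ` C"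
      using finite_subset_image[OF \<F>(1,2)] by (elim exE conjE)
    have cover: "prob_measures \<subseteq> (\<Union>\<mu>\<in>C. rho.mball \<mu> (\<epsilon> \<mu>))" using \<F>(3) C(3) by simp
    define K where "K = Max (k ` C)"
    have "?B K \<subseteq> (\<Union>\<mu>\<in>C. ?B (k \<mu>) \<inter> basin F T \<mu> (\<epsilon> \<mu>))"
    proof
      fix x assume x: "x \<in> ?B K"
      obtain \<nu> where \<nu>: "\<nu> \<in> limit_measures T x" using limit_measures_nonempty by blast
      then obtain \<mu> where \<mu>: "\<mu> \<in> C" "\<nu> \<in> rho.mball \<mu> (\<epsilon> \<mu>)"
        using cover limit_measures_prob by blast
      have "x \<in> basin F T \<mu> (\<epsilon> \<mu>)"
        using in_basin_if_near_limit_measure[OF \<nu>] \<mu>(2) by auto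
      moreover have "k \<mu> \<le> K" unfolding K_def using C(2) \<mu>(1) by simp
      then have "1 / real (Suc K) \<le> 1 / real (Suc (k \<mu>))" by (simp add: divide_simps)
      then have "x \<in> ?B (k \<mu>)" using x by simp
      ultimately show "x \<in> (\<Union>\<mu>\<in>C. ?B (k \<mu>) \<inter> basin F T \<mu> (\<epsilon> \<mu>))" using \<mu>(1) by blast
    qed
    moreover have "(\<Union>\<mu>\<in>C. ?B (k \<mu>) \<inter> basin F T \<mu> (\<epsilon> \<mu>)) \<in> null_sets m"
      using C(1,2) null(2) meas by (intro null_sets.finite_UN) (auto simp: null_sets_def)
    ultimately have "emeasure m (?B K) = 0"
      using null_sets_subset[of _ m "?B K"] sets_m by (auto simp: null_sets_def)
    moreover have "emeasure m (?B K) > 0" by (rule pos) auto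
    ultimately show False by simp
  qed
  then obtain \<mu> where \<mu>: "\<mu> \<in> prob_measures"
    and mpos: "\<And>k \<epsilon>. \<epsilon> > 0 \<Longrightarrow> emeasure m (?B k \<inter> basin F T \<mu> \<epsilon>) > 0" by blast
  have "emeasure m (basin F T \<mu> \<epsilon>) > 0" if "\<epsilon> > 0" for \<epsilon>
  proof -
    have "emeasure m (?B 0 \<inter> basin F T \<mu> \<epsilon>) \<le> emeasure m (basin F T \<mu> \<epsilon>)"
      using basin_borel[OF \<mu>] sets_m by (intro emeasure_mono) auto
    with mpos[OF that, of 0] show ?thesis by (rule less_le_trans)
  qed
  then have "\<mu> \<in> physical_like F T m" using \<mu> by (simp add: physical_like_def)
  moreover have "dense (basin F T \<mu> \<epsilon>)" if "\<epsilon> > 0" for \<epsilon>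
    unfolding dense_iff_meets_open
  proof (intro allI impI)
    fix U :: "'a set" assume "open U" "U \<noteq> {}"
    then obtain n where "y \<in> (T ^^ n) -` U" using y unfolding Trans_iff by blast
    then obtain r where r: "r > 0" "ball y r \<subseteq> (T ^^ n) -` U"
      using open_funpow_vimage[OF \<open>open U\<close>] by (meson openE)
    obtain k where "1 / real (Suc k) < r"
      using reals_Archimedean[OF r(1)] by (auto simp: inverse_eq_divide)
    then have "?B k \<subseteq> ball y r" by (intro subset_ball) simp
    moreover have "?B k \<inter> basin F T \<mu> \<epsilon> \<noteq> {}" using mpos[OF that, of k] by (metis emeasure_empty less_irrefl)
    ultimately obtain x where "x \<in> (T ^^ n) -` U" "x \<in> basin F T \<mu> \<epsilon>" using r(2) by blast
    then show "basin F T \<mu> \<epsilon> \<inter> U \<noteq> {}" using basin_funpow[of n x \<mu> \<epsilon>] by auto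
  qed
  then have "\<mu> \<in> M_Trans T" using \<mu> by (simp add: dense_basin_measures_eq[symmetric] dense_basin_measures_def)
  ultimately show ?thesis by blast
qed

end

lemma manifold_lebesgue_open_pos:
  fixes A :: "('a::topological_space set \<times> ('a \<Rightarrow> 'e::euclidean_space)) set"
  assumes A: "C1_atlas A" and m: "manifold_lebesgue A m" and W: "open W" "W \<noteq> {}"
  shows "emeasure m W > 0"
proof -
  obtain x where "x \<in> W" using W by blast
  moreover have "x \<in> (\<Union>(U, \<phi>)\<in>A. U)" using A unfolding C1_atlas_def by simp
  ultimately obtain U \<phi> where U: "(U, \<phi>) \<in> A" "x \<in> U" by blast
  have op: "open U" "open (\<phi> ` U)" "homeomorphism U (\<phi> ` U) \<phi> (inv_into U \<phi>)"
    using A U(1) unfolding C1_atlas_def by auto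
  obtain g :: "'e \<Rightarrow> real" where g: "continuous_on (\<phi> ` U) g" "\<And>y. y \<in> \<phi> ` U \<Longrightarrow> g y > 0"
    "\<And>B. B \<in> sets borel \<Longrightarrow> B \<subseteq> U \<Longrightarrow> emeasure m B = (\<integral>\<^sup>+ y\<in>\<phi> ` B. ennreal (g y) \<partial>lborel)"
    using bspec[OF conjunct2[OF m[unfolded manifold_lebesgue_def]] U(1)] by auto
  let ?B = "W \<inter> U" and ?y = "\<phi> x"
  have "openin (top_of_set (\<phi> ` U)) (\<phi> ` ?B)"
    by (rule homeomorphism_imp_open_map[OF op(3)]) (use W(1) op(1) in \<open>auto intro: open_subset\<close>)
  then have "open (\<phi> ` ?B)" using op(2) openin_open_trans by blast
  \<comment> \<open>Near the image of the point the density exceeds half of its value there.\<close>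
  define c where "c = g ?y / 2"
  have c: "c > 0" "c < g ?y" using g(2)[of ?y] U(2) by (auto simp: c_def)
  have cont: "continuous_on (\<phi> ` ?B) g" by (rule continuous_on_subset[OF g(1)]) auto
  have "open (\<phi> ` ?B \<inter> g -` {c<..})"
    using continuous_open_preimage[OF cont \<open>open (\<phi> ` ?B)\<close>, of "{c<..}"] by simp
  moreover have "?y \<in> \<phi> ` ?B \<inter> g -` {c<..}" using c U(2) \<open>x \<in> W\<close> by auto
  ultimately obtain r where r: "r > 0" "ball ?y r \<subseteq> \<phi> ` ?B \<inter> g -` {c<..}"
    by (meson openE)
  have "0 < ennreal c * emeasure lborel (ball ?y r)"
    using c(1) r(1) by (simp add: ennreal_zero_less_mult_iff emeasure_ball)
  also have "\<dots> = (\<integral>\<^sup>+ y. ennreal c * indicator (ball ?y r) y \<partial>lborel)"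
    by (simp add: nn_integral_cmult_indicator)
  also have "\<dots> \<le> (\<integral>\<^sup>+ y\<in>\<phi> ` ?B. ennreal (g y) \<partial>lborel)"
    using r(2) by (intro nn_integral_mono) (auto simp: indicator_def intro!: ennreal_leI)
  also have "\<dots> = emeasure m ?B"
    using g(3)[of ?B] W(1) op(1) by simp
  also have "\<dots> \<le> emeasure m W"
    using m W(1) unfolding manifold_lebesgue_def by (intro emeasure_mono) auto
  finally show ?thesis .
qed

section \<open>Functions with residual irregular sets\<close>

lemma open_integrals_differ:
  assumes "M \<subseteq> prob_measures"
  shows "open {f :: 'a::topological_space \<Rightarrow>\<^sub>C real. \<exists>\<mu>\<in>M. \<exists>\<nu>\<in>M. (\<integral>z. f z \<partial>\<mu>) \<noteq> (\<integral>z. f z \<partial>\<nu>)}"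
proof -
  have cont: "continuous_on UNIV (\<lambda>f :: 'a \<Rightarrow>\<^sub>C real. \<integral>z. f z \<partial>\<mu>)" if "\<mu> \<in> M" for \<mu>
    using bounded_linear_integral_bcontfun[of \<mu>] that assms
    by (intro linear_continuous_on) auto
  have "{f :: 'a \<Rightarrow>\<^sub>C real. \<exists>\<mu>\<in>M. \<exists>\<nu>\<in>M. (\<integral>z. f z \<partial>\<mu>) \<noteq> (\<integral>z. f z \<partial>\<nu>)}
      = (\<Union>\<mu>\<in>M. \<Union>\<nu>\<in>M. {f :: 'a \<Rightarrow>\<^sub>C real. (\<integral>z. f z \<partial>\<mu>) \<noteq> (\<integral>z. f z \<partial>\<nu>)})"
    by auto
  also have "open \<dots>"
    by (intro open_UN ballI open_Collect_neq cont)
  finally show ?thesis .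
qed

text \<open>
  Adding a small multiple of one separating function separates two measures that a given
  function does not.
\<close>

lemma dense_integrals_differ:
  fixes g :: "'a::topological_space \<Rightarrow>\<^sub>C real"
  assumes M: "M \<subseteq> prob_measures" "\<mu> \<in> M" "\<nu> \<in> M" and g: "(\<integral>z. g z \<partial>\<mu>) \<noteq> (\<integral>z. g z \<partial>\<nu>)"
  shows "dense {f :: 'a \<Rightarrow>\<^sub>C real. \<exists>\<mu>\<in>M. \<exists>\<nu>\<in>M. (\<integral>z. f z \<partial>\<mu>) \<noteq> (\<integral>z. f z \<partial>\<nu>)}" (is "dense ?R")
  unfolding dense_iff_meets_open
proof (intro allI impI)
  fix U :: "('a \<Rightarrow>\<^sub>C real) set" assume "open U" "U \<noteq> {}"
  then obtain f e where f: "f \<in> U" "e > 0" "ball f e \<subseteq> U" by (meson openE ex_in_conv)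
  show "?R \<inter> U \<noteq> {}"
  proof (cases "f \<in> ?R")
    case False
    \<comment> \<open>The factor makes the perturbation shorter than the radius; adding one to the norm keeps the
      denominator positive.\<close>
    define t where "t = e / (2 * (norm g + 1))"
    have "norm g + 1 > 0" using norm_ge_zero[of g] by linarith
    then have "t > 0" "t * norm g < e"
      using f(2) by (auto simp: t_def field_simps intro!: add_nonneg_pos)
    then have "f + t *\<^sub>R g \<in> U" using f(3) by (auto simp: dist_norm subset_iff)
    have split: "(\<integral>z. (f + t *\<^sub>R g) z \<partial>\<kappa>) = (\<integral>z. f z \<partial>\<kappa>) + t * (\<integral>z. g z \<partial>\<kappa>)" if "\<kappa> \<in> M" for \<kappa>
      using integrable_bcontfun[of \<kappa>] that M(1) by auto
    have "(\<integral>z. f z \<partial>\<mu>) = (\<integral>z. f z \<partial>\<nu>)" using False M(2,3) by blast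
    then have "(\<integral>z. (f + t *\<^sub>R g) z \<partial>\<mu>) \<noteq> (\<integral>z. (f + t *\<^sub>R g) z \<partial>\<nu>)"
      using g \<open>t > 0\<close> unfolding split[OF M(2)] split[OF M(3)] by simp
    then have "f + t *\<^sub>R g \<in> ?R" using M(2,3) by blast
    with \<open>f + t *\<^sub>R g \<in> U\<close> show ?thesis by blast
  qed (use f in blast)
qed

context transitive_dynamics
begin

text \<open>
  A generic point is irregular for a function if and only if two measures of
  \<^const>\<open>M_Trans\<close> have different integrals. By Baire, a residual irregular set
  contains a generic point; conversely, an irregular set that contains all generic points is
  residual.
\<close>

lemma residually_irregular_eq:
  "residually_irregular T = {f :: 'a \<Rightarrow>\<^sub>C real. \<exists>\<mu>\<in>M_Trans T. \<exists>\<nu>\<in>M_Trans T. (\<integral>z. f z \<partial>\<mu>) \<noteq> (\<integral>z. f z \<partial>\<nu>)}"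
proof -
  have irr: "x \<in> irregular_set T f \<longleftrightarrow> (\<exists>\<mu>\<in>M_Trans T. \<exists>\<nu>\<in>M_Trans T. (\<integral>z. f z \<partial>\<mu>) \<noteq> (\<integral>z. f z \<partial>\<nu>))"
    if "x \<in> generic_points" for x f
    using that by (intro irregular_iff_integrals_differ) (simp add: generic_points_def)
  show ?thesis
  proof (intro set_eqI iffI)
    fix f assume "f \<in> residually_irregular T"
    then have "irregular_set T f \<inter> generic_points \<noteq> {}"
      by (simp add: residually_irregular_def residual_meets_generic)
    then show "f \<in> {f :: 'a \<Rightarrow>\<^sub>C real. \<exists>\<mu>\<in>M_Trans T. \<exists>\<nu>\<in>M_Trans T. (\<integral>z. f z \<partial>\<mu>) \<noteq> (\<integral>z. f z \<partial>\<nu>)}"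
      using irr by blast
  next
    fix f :: "'a \<Rightarrow>\<^sub>C real"
    assume "f \<in> {f :: 'a \<Rightarrow>\<^sub>C real. \<exists>\<mu>\<in>M_Trans T. \<exists>\<nu>\<in>M_Trans T. (\<integral>z. f z \<partial>\<mu>) \<noteq> (\<integral>z. f z \<partial>\<nu>)}"
    then have "generic_points \<subseteq> irregular_set T f" using irr by blast
    then show "f \<in> residually_irregular T"
      using residual_generic_points unfolding residually_irregular_def residual_def by blast
  qed
qed

lemma generic_points_irregular:
  "generic_points \<subseteq> (\<Inter>f\<in>residually_irregular T. irregular_set T f)"
  unfolding residually_irregular_eq
  using irregular_iff_integrals_differ[of _ "M_Trans T"] by (auto simp: generic_points_def)

lemma residually_irregular_open_dense:
  assumes "\<mu> \<in> M_Trans T" "\<nu> \<in> M_Trans T" "\<mu> \<noteq> \<nu>"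
  shows "open (residually_irregular T)" "dense (residually_irregular T)"
proof -
  show "open (residually_irregular T)"
    unfolding residually_irregular_eq by (rule open_integrals_differ[OF M_Trans_prob])
  obtain g :: "'a \<Rightarrow>\<^sub>C real" where "(\<integral>z. g z \<partial>\<mu>) \<noteq> (\<integral>z. g z \<partial>\<nu>)"
    using separating_bcontfun[of \<mu> \<nu>] assms M_Trans_prob by blast
  then show "dense (residually_irregular T)"
    unfolding residually_irregular_eq using dense_integrals_differ[OF M_Trans_prob assms(1,2)] by blast
qed

end

section \<open>The theorem on generic limit measures\<close>

theorem theorem2:
  fixes T :: "'a::metric_space \<Rightarrow> 'a"
    and F :: "nat \<Rightarrow> 'a \<Rightarrow>\<^sub>C real"
  assumes "compact (UNIV :: 'a set)"
    and "continuous_on UNIV T"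
    and "metrizing_family F"
    and "transitive_system T"
  shows "M_dense F T = M_Trans T \<and>
    (\<exists>Y. residual Y \<and> invariant T Y \<and>
      (\<forall>x\<in>Y. \<forall>f :: 'a \<Rightarrow>\<^sub>C real.
        (x \<in> Trans T \<and> limit_measures T x = M_Trans T) \<and>
        (lower_average T f x = (INF y\<in>Trans T. lower_average T f y) \<and>
         (INF y\<in>Trans T. lower_average T f y) = (INF \<mu>\<in>M_Trans T. ereal (\<integral>z. f z \<partial>\<mu>)) \<and>
         (INF \<mu>\<in>M_Trans T. ereal (\<integral>z. f z \<partial>\<mu>)) \<le> (SUP \<mu>\<in>M_Trans T. ereal (\<integral>z. f z \<partial>\<mu>)) \<and>
         (SUP \<mu>\<in>M_Trans T. ereal (\<integral>z. f z \<partial>\<mu>)) = (SUP y\<in>Trans T. upper_average T f y) \<and>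
         (SUP y\<in>Trans T. upper_average T f y) = upper_average T f x) \<and>
        (\<forall>(A :: ('a set \<times> ('a \<Rightarrow> 'e::euclidean_space)) set) m.
          C1_atlas A \<and> manifold_lebesgue A m \<longrightarrow>
          limit_measures T x \<inter> physical_like F T m \<noteq> {})) \<and>
      ((\<exists>\<mu>\<in>M_Trans T. \<exists>\<nu>\<in>M_Trans T. \<mu> \<noteq> \<nu>) \<longrightarrow>
        open (residually_irregular T) \<and> dense (residually_irregular T) \<and>
        Y \<subseteq> (\<Inter>f\<in>residually_irregular T. irregular_set T f)))"
proof -
  interpret transitive_dynamics T F
    by unfold_locales (rule assms)+
  have gen: "x \<in> Trans T" "limit_measures T x = M_Trans T" if "x \<in> generic_points" for x
    using that by (simp_all add: generic_points_def)
  have phys: "limit_measures T x \<inter> physical_like F T m \<noteq> {}"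
    if "x \<in> generic_points" "C1_atlas A" "manifold_lebesgue A m"
    for x m and A :: "('a set \<times> ('a \<Rightarrow> 'e::euclidean_space)) set"
    unfolding gen(2)[OF that(1)]
    using that(3) manifold_lebesgue_open_pos[OF that(2,3)]
    by (intro physical_like_exists) (simp_all add: manifold_lebesgue_def)
  have inf_sup: "(INF \<mu>\<in>M_Trans T. ereal (\<integral>z. f z \<partial>\<mu>)) \<le> (SUP \<mu>\<in>M_Trans T. ereal (\<integral>z. f z \<partial>\<mu>))"
    for f :: "'a \<Rightarrow>\<^sub>C real"
    by (rule INF_le_SUP[OF M_Trans_nonempty])
  show ?thesis
  proof (intro conjI exI[of _ generic_points] ballI allI impI)
    fix x assume x: "x \<in> generic_points"
    show "x \<in> Trans T" "limit_measures T x = M_Trans T" using gen[OF x] .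
  next
    fix x and f :: "'a \<Rightarrow>\<^sub>C real" assume x: "x \<in> generic_points"
    show "lower_average T f x = (INF y\<in>Trans T. lower_average T f y)"
      unfolding INF_lower_average_Trans unfolding lower_average_eq_INF gen(2)[OF x] ..
    show "(SUP y\<in>Trans T. upper_average T f y) = upper_average T f x"
      unfolding SUP_upper_average_Trans unfolding upper_average_eq_SUP gen(2)[OF x] ..
    show "(INF y\<in>Trans T. lower_average T f y) = (INF \<mu>\<in>M_Trans T. ereal (\<integral>z. f z \<partial>\<mu>))"
      by (rule INF_lower_average_Trans)
    show "(SUP \<mu>\<in>M_Trans T. ereal (\<integral>z. f z \<partial>\<mu>)) = (SUP y\<in>Trans T. upper_average T f y)"
      by (rule SUP_upper_average_Trans[symmetric])
    show "(INF \<mu>\<in>M_Trans T. ereal (\<integral>z. f z \<partial>\<mu>)) \<le> (SUP \<mu>\<in>M_Trans T. ereal (\<integral>z. f z \<partial>\<mu>))"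
      by (rule inf_sup)
  next
    fix x m and A :: "('a set \<times> ('a \<Rightarrow> 'e)) set"
    assume "x \<in> generic_points" "C1_atlas A \<and> manifold_lebesgue A m"
    then show "limit_measures T x \<inter> physical_like F T m \<noteq> {}" using phys by blast
  next
    assume "\<exists>\<mu>\<in>M_Trans T. \<exists>\<nu>\<in>M_Trans T. \<mu> \<noteq> \<nu>"
    then show "open (residually_irregular T)" "dense (residually_irregular T)"
      using residually_irregular_open_dense by blast+
  qed (rule M_dense_eq residual_generic_points invariant_generic_points generic_points_irregular)+
qed

end
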